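(* Let $G$ be a subgroup of $\mathbf V(r,\mathbb R^*_+,\mathbb R)$ such that $G\cap \mathbf F(r,\mathbb R^*_+,\mathbb R)=\mathbf F(r,\Lambda,A)$. Then the group $G$ interprets the Arithmetic $(\mathbb N,+,\times)$ with parameters.
   Context: Maps act on the right: $(\alpha)x$ is the image of $\alpha$ under $x$, and $xy$ means "first $x$, then $y$". Fix a real $r>0$, a subgroup $\Lambda\neq\{1\}$ of the multiplicative group $\mathbb R^*_+$ of positive reals, and an additive subgroup $A\subseteq\mathbb R$ with $r\in A$ and $\lambda A\subseteq A$ for all $\lambda\in\Lambda$ (the same definitions are also used with $\Lambda=\mathbb R^*_+$, $A=\mathbb R$). $\mathbf V(r,\Lambda,A)$ is the group of all bijections $x\colon[0,r)\to[0,r)$ such that: $x$ is piecewise affine with finitely many breakpoints and discontinuity points; $x$ is right-continuous at every point; the slope of each affine piece lies in $\Lambda$; all breakpoints and discontinuity points of $x$, and their images, lie in $A$. $\mathbf F(r,\Lambda,A)$ is the subgroup of elements of $\mathbf V(r,\Lambda,A)$ continuous for the usual topology of $[0,r)$. Groups are viewed as first-order structures in the language with one binary function symbol (multiplication). An interpretation with parameters of a structure $M$ in a structure $N$ is a pair $(n,f)$ with $n\in\mathbb N$ and $f$ a surjection from a subset of $N^n$ onto $M$ such that for every subset $X\subseteq M^k$ definable in $M$ without parameters, the preimage of $X$ under the coordinatewise map $f^{\underline k}$ is first-order definable in $N$ with parameters from $N$; it is an interpretation without parameters if all these preimages are definable without parameters. (Equivalently: the domain of $f$, the kernel equivalence relation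 of $f$, and the preimages of the graphs of all basic relations, operations and constants of $M$ are definable, resp. definable without parameters.) *)

theory Defs
  imports Complex_Main "HOL-Algebra.Group"
begin

text \<open>An element of V(r,Lambda,A) is represented by a function real => real that is the
  identity outside [0,r) and restricts to a bijection of [0,r). The piecewise affine
  structure is witnessed by a subdivision 0 = a 0 < a 1 < ... < a n = r with all
  subdivision points in A, their images in A, and on each [a i, a (i+1)) the map is
  affine with slope in Lambda (this gives right-continuity automatically).\<close>

definition PL_V :: "real \<Rightarrow> real set \<Rightarrow> real set \<Rightarrow> (real \<Rightarrow> real) set" where
  "PL_V r \<Lambda> A = {f.
     (\<forall>t. t \<notin> {0..<r} \<longrightarrow> f t = t) \<and>
     bij_betw f {0..<r} {0..<r} \<and>
     (\<exists>(n::nat) (a::nat \<Rightarrow> real).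
        a 0 = 0 \<and> a n = r \<and>
        (\<forall>i<n. a i < a (Suc i)) \<and>
        (\<forall>i\<le>n. a i \<in> A) \<and>
        (\<forall>i<n. f (a i) \<in> A \<and>
           (\<exists>s\<in>\<Lambda>. \<exists>c. \<forall>t\<in>{a i..<a (Suc i)}. f t = s * t + c)))}"

definition PL_F :: "real \<Rightarrow> real set \<Rightarrow> real set \<Rightarrow> (real \<Rightarrow> real) set" where
  "PL_F r \<Lambda> A = {f \<in> PL_V r \<Lambda> A. continuous_on {0..<r} f}"

text \<open>Maps act on the right: the product x y means first x, then y, i.e. y o x.\<close>

definition Vgrp :: "real \<Rightarrow> real set \<Rightarrow> real set \<Rightarrow> (real \<Rightarrow> real) monoid" where
  "Vgrp r \<Lambda> A = \<lparr>carrier = PL_V r \<Lambda> A, mult = (\<lambda>x y. y \<circ> x), one = id\<rparr>"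

datatype 'tm fm = FEq 'tm 'tm | FNot "'tm fm" | FAnd "'tm fm" "'tm fm" | FEx nat "'tm fm"

fun sat :: "'a set \<Rightarrow> ((nat \<Rightarrow> 'a) \<Rightarrow> 'tm \<Rightarrow> 'a) \<Rightarrow> (nat \<Rightarrow> 'a) \<Rightarrow> 'tm fm \<Rightarrow> bool" where
  "sat D ev e (FEq s t) = (ev e s = ev e t)"
| "sat D ev e (FNot \<phi>) = (\<not> sat D ev e \<phi>)"
| "sat D ev e (FAnd \<phi> \<psi>) = (sat D ev e \<phi> \<and> sat D ev e \<psi>)"
| "sat D ev e (FEx i \<phi>) = (\<exists>a\<in>D. sat D ev (e(i := a)) \<phi>)"

definition env :: "'a \<Rightarrow> 'a list \<Rightarrow> nat \<Rightarrow> 'a" where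
  "env d xs i = (if i < length xs then xs ! i else d)"

datatype gtm = GVar nat | GMul gtm gtm

fun geval :: "('a \<Rightarrow> 'a \<Rightarrow> 'a) \<Rightarrow> (nat \<Rightarrow> 'a) \<Rightarrow> gtm \<Rightarrow> 'a" where
  "geval m e (GVar i) = e i"
| "geval m e (GMul s t) = m (geval m e s) (geval m e t)"

datatype atm = AVar nat | APlus atm atm | ATimes atm atm

fun aeval :: "(nat \<Rightarrow> nat) \<Rightarrow> atm \<Rightarrow> nat" where
  "aeval e (AVar i) = e i"
| "aeval e (APlus s t) = aeval e s + aeval e t"
| "aeval e (ATimes s t) = aeval e s * aeval e t"

definition arith_definable :: "nat \<Rightarrow> nat list set \<Rightarrow> bool" where
  "arith_definable k X \<longleftrightarrow>
     (\<exists>\<phi>::atm fm. X = {ns. length ns = k \<and> sat UNIV aeval (env 0 ns) \<phi>})"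

text \<open>Subsets of S^k definable with parameters in the group (S, m) with identity e
  (parameters are the variables k, k+1, ...; unassigned variables get the identity,
  which is itself definable without parameters).\<close>
definition grp_definable_params ::
  "'a set \<Rightarrow> ('a \<Rightarrow> 'a \<Rightarrow> 'a) \<Rightarrow> 'a \<Rightarrow> nat \<Rightarrow> 'a list set \<Rightarrow> bool" where
  "grp_definable_params S m e k X \<longleftrightarrow>
     (\<exists>(\<phi>::gtm fm) ps. set ps \<subseteq> S \<and>
        X = {xs. length xs = k \<and> set xs \<subseteq> S \<and> sat S (geval m) (env e (xs @ ps)) \<phi>})"

text \<open>The group (S, m) interprets (N,+,*) with parameters: there are n and a surjection f
  from a subset D of S^n onto N such that the preimage under f^k of every parameter-free
  definable subset of N^k is definable with parameters in the group (tuples of n-tuples are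
  identified with (n*k)-tuples by concatenation).\<close>
definition interprets_arith_params :: "'a set \<Rightarrow> ('a \<Rightarrow> 'a \<Rightarrow> 'a) \<Rightarrow> 'a \<Rightarrow> bool" where
  "interprets_arith_params S m e \<longleftrightarrow>
     (\<exists>(n::nat) (D::'a list set) (f::'a list \<Rightarrow> nat).
        D \<subseteq> {xs. length xs = n \<and> set xs \<subseteq> S} \<and> f ` D = UNIV \<and>
        (\<forall>k X. arith_definable k X \<longrightarrow>
           grp_definable_params S m e (n * k)
             {concat xss | xss. length xss = k \<and> set xss \<subseteq> D \<and> map f xss \<in> X}))"

end

theory Submission
  imports Defs
begin

text \<open>Choose three parameters in the group \<open>F(r,\<Lambda>,A) \<subseteq> G\<close>: a map \<open>t\<close> without fixed points in
  \<open>(0,r)\<close>, a map \<open>a\<close> whose support is the fundamental domain \<open>(e, t e)\<close> of \<open>t\<close>, and a map \<open>u\<close> with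
  support \<open>(0,e)\<close>. The breakpoints of \<open>t\<close> are chosen so that its centralizer in \<open>G\<close> is \<open>{t\<^sup>n}\<close>;
  among these powers the ones with \<open>n \<ge> 0\<close> are those for which the conjugate of \<open>a\<close> by \<open>t\<^sup>n\<close>
  commutes with \<open>u\<close>. Elements of \<open>G\<close> commuting with all conjugates of \<open>a\<close> by powers of \<open>t\<close> preserve
  every fundamental domain; being affine near \<open>0\<close> and near \<open>r\<close> they are the identity on all but
  finitely many of them. Hence, as in the wreath product of two infinite cyclic groups, the equation
  \<open>[b, t\<^sup>m] = [a, t\<^sup>n]\<close> has such a solution \<open>b\<close> iff \<open>m\<close> divides \<open>n\<close>. Finally, multiplication on \<open>\<nat>\<close>
  is definable from addition and divisibility.\<close>

section \<open>Definable relations\<close>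

definition finitely_supported :: "((nat \<Rightarrow> 'a) \<Rightarrow> 'b) \<Rightarrow> bool" where
  "finitely_supported F \<longleftrightarrow> (\<exists>V. finite V \<and> (\<forall>g g'. (\<forall>i\<in>V. g i = g' i) \<longrightarrow> F g = F g'))"

lemma finitely_supportedE:
  assumes "finitely_supported F"
  obtains V where "finite V" "\<And>g g'. \<forall>i\<in>V. g i = g' i \<Longrightarrow> F g = F g'"
  using assms unfolding finitely_supported_def by blast

lemma finitely_supported_combine:
  assumes "finitely_supported F" "finitely_supported F'"
  shows "finitely_supported (\<lambda>g. h (F g) (F' g))"
proof -
  obtain V where V: "finite V" "\<And>g g'. \<forall>i\<in>V. g i = g' i \<Longrightarrow> F g = F g'"
    using assms(1) by (rule finitely_supportedE) blast
  obtain W where W: "finite W" "\<And>g g'. \<forall>i\<in>W. g i = g' i \<Longrightarrow> F' g = F' g'"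
    using assms(2) by (rule finitely_supportedE) blast
  have "h (F g) (F' g) = h (F g') (F' g')" if "\<forall>i\<in>V \<union> W. g i = g' i" for g g'
    using V(2)[of g g'] W(2)[of g g'] that by simp
  then show ?thesis unfolding finitely_supported_def using V(1) W(1)
    by (intro exI[of _ "V \<union> W"]) simp
qed

lemma finitely_supported_geval: "finitely_supported (\<lambda>g. geval m g s)"
proof (induction s)
  case (GVar i)
  show ?case unfolding finitely_supported_def by (rule exI[of _ "{i}"]) simp
next
  case (GMul s t)
  then show ?case using finitely_supported_combine[where h = m] by simp
qed

lemma finitely_supported_sat: "finitely_supported (\<lambda>g. sat S (geval m) g \<phi>)"
proof (induction \<phi>)
  case (FEq s t)
  show ?case
    using finitely_supported_combine[OF finitely_supported_geval finitely_supported_geval,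
        where h = "(=)"] by simp
next
  case (FNot \<phi>)
  then show ?case using finitely_supported_combine[where h = "\<lambda>x y. \<not> x"] by simp
next
  case (FAnd \<phi> \<psi>)
  then show ?case using finitely_supported_combine[where h = "(\<and>)"] by simp
next
  case (FEx j \<phi>)
  obtain V where V: "finite V"
    "\<And>g g'. \<forall>i\<in>V. g i = g' i \<Longrightarrow> sat S (geval m) g \<phi> = sat S (geval m) g' \<phi>"
    using finitely_supportedE[OF FEx] by blast
  have "sat S (geval m) g (FEx j \<phi>) = sat S (geval m) g' (FEx j \<phi>)" if "\<forall>i\<in>V. g i = g' i" for g g'
    using V(2)[of "g(j := x)" "g'(j := x)" for x] that by simp
  then show ?case unfolding finitely_supported_def using V(1) by blast
qed

lemma ex_renamed_term: "\<exists>s'. \<forall>g. geval m g s' = geval m (\<lambda>i. g (\<pi> i)) s"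
proof (induction s)
  case (GVar i)
  show ?case by (rule exI[of _ "GVar (\<pi> i)"]) simp
next
  case (GMul s t)
  then obtain s' t' where "\<And>g. geval m g s' = geval m (\<lambda>i. g (\<pi> i)) s"
    "\<And>g. geval m g t' = geval m (\<lambda>i. g (\<pi> i)) t"
    by blast
  then show ?case by (intro exI[of _ "GMul s' t'"]) simp
qed

lemma ex_renamed_formula:
  "\<exists>\<psi>. \<forall>g. sat S (geval m) g \<psi> \<longleftrightarrow> sat S (geval m) (\<lambda>i. g (\<pi> i)) \<phi>"
proof (induction \<phi> arbitrary: \<pi>)
  case (FEq s t)
  obtain s' t' where "\<And>g. geval m g s' = geval m (\<lambda>i. g (\<pi> i)) s"
    "\<And>g. geval m g t' = geval m (\<lambda>i. g (\<pi> i)) t"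
    using ex_renamed_term by blast
  then show ?case by (intro exI[of _ "FEq s' t'"]) simp
next
  case (FNot \<phi>)
  then obtain \<psi> where "\<And>g. sat S (geval m) g \<psi> \<longleftrightarrow> sat S (geval m) (\<lambda>i. g (\<pi> i)) \<phi>" by blast
  then show ?case by (intro exI[of _ "FNot \<psi>"]) simp
next
  case (FAnd \<phi> \<phi>')
  then obtain \<psi> \<psi>' where "\<And>g. sat S (geval m) g \<psi> \<longleftrightarrow> sat S (geval m) (\<lambda>i. g (\<pi> i)) \<phi>"
    "\<And>g. sat S (geval m) g \<psi>' \<longleftrightarrow> sat S (geval m) (\<lambda>i. g (\<pi> i)) \<phi>'" by blast
  then show ?case by (intro exI[of _ "FAnd \<psi> \<psi>'"]) simp
next
  case (FEx i \<phi>)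
  obtain V where V: "finite V"
    "\<And>g g'. \<forall>l\<in>V. g l = g' l \<Longrightarrow> sat S (geval m) g \<phi> = sat S (geval m) g' \<phi>"
    using finitely_supportedE[OF finitely_supported_sat[of S m \<phi>]] by blast
  obtain j where j: "j \<notin> \<pi> ` V" using V(1) ex_new_if_finite infinite_UNIV_nat by blast
  obtain \<psi> where \<psi>: "\<And>g. sat S (geval m) g \<psi> \<longleftrightarrow> sat S (geval m) (\<lambda>l. g ((\<pi>(i := j)) l)) \<phi>"
    using FEx[of "\<pi>(i := j)"] by blast
  have "sat S (geval m) (g(j := x)) \<psi> \<longleftrightarrow> sat S (geval m) ((\<lambda>l. g (\<pi> l))(i := x)) \<phi>" for g x
    unfolding \<psi> by (rule V(2)) (use j in auto)
  then have "sat S (geval m) g (FEx j \<psi>) \<longleftrightarrow> sat S (geval m) (\<lambda>i. g (\<pi> i)) (FEx i \<phi>)" for g by simp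
  then show ?case by blast
qed

definition append_env :: "'a list \<Rightarrow> (nat \<Rightarrow> 'a) \<Rightarrow> nat \<Rightarrow> 'a" where
  "append_env ps g i = (if i < length ps then ps ! i else g (i - length ps))"

definition definable_term :: "('a \<Rightarrow> 'a \<Rightarrow> 'a) \<Rightarrow> 'a list \<Rightarrow> ((nat \<Rightarrow> 'a) \<Rightarrow> 'a) \<Rightarrow> bool" where
  "definable_term m ps f \<longleftrightarrow> (\<exists>s. \<forall>g. geval m (append_env ps g) s = f g)"

definition definable ::
  "'a set \<Rightarrow> ('a \<Rightarrow> 'a \<Rightarrow> 'a) \<Rightarrow> 'a list \<Rightarrow> ((nat \<Rightarrow> 'a) \<Rightarrow> bool) \<Rightarrow> bool" where
  "definable S m ps R \<longleftrightarrow>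
     (\<exists>\<phi>. \<forall>g. range g \<subseteq> S \<longrightarrow> (sat S (geval m) (append_env ps g) \<phi> \<longleftrightarrow> R g))"

lemma definable_term_var: "definable_term m ps (\<lambda>g. g i)"
  unfolding definable_term_def append_env_def by (rule exI[of _ "GVar (length ps + i)"]) simp

lemma definable_term_param:
  assumes "p \<in> set ps"
  shows "definable_term m ps (\<lambda>g. p)"
proof -
  obtain i where "i < length ps" "ps ! i = p" using assms unfolding in_set_conv_nth by blast
  then show ?thesis unfolding definable_term_def append_env_def by (intro exI[of _ "GVar i"]) simp
qed

lemma definable_term_mult:
  assumes "definable_term m ps f" "definable_term m ps f'"
  shows "definable_term m ps (\<lambda>g. m (f g) (f' g))"
proof -
  obtain s s' where "\<And>g. geval m (append_env ps g) s = f g"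
    "\<And>g. geval m (append_env ps g) s' = f' g"
    using assms unfolding definable_term_def by blast
  then show ?thesis unfolding definable_term_def by (intro exI[of _ "GMul s s'"]) simp
qed

lemma definable_cong:
  "(\<And>g. range g \<subseteq> S \<Longrightarrow> R g \<longleftrightarrow> R' g) \<Longrightarrow> definable S m ps R \<longleftrightarrow> definable S m ps R'"
  unfolding definable_def by (simp cong: imp_cong)

lemma definable_eq:
  assumes "definable_term m ps f" "definable_term m ps f'"
  shows "definable S m ps (\<lambda>g. f g = f' g)"
proof -
  obtain s s' where "\<And>g. geval m (append_env ps g) s = f g"
    "\<And>g. geval m (append_env ps g) s' = f' g"
    using assms unfolding definable_term_def by blast
  then show ?thesis unfolding definable_def by (intro exI[of _ "FEq s s'"]) simp
qed

lemma definable_not: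
  assumes "definable S m ps R"
  shows "definable S m ps (\<lambda>g. \<not> R g)"
proof -
  obtain \<phi> where "\<And>g. range g \<subseteq> S \<Longrightarrow> sat S (geval m) (append_env ps g) \<phi> \<longleftrightarrow> R g"
    using assms unfolding definable_def by blast
  then show ?thesis unfolding definable_def by (intro exI[of _ "FNot \<phi>"]) simp
qed

lemma definable_conj:
  assumes "definable S m ps R" "definable S m ps R'"
  shows "definable S m ps (\<lambda>g. R g \<and> R' g)"
proof -
  obtain \<phi> \<psi> where "\<And>g. range g \<subseteq> S \<Longrightarrow> sat S (geval m) (append_env ps g) \<phi> \<longleftrightarrow> R g"
    "\<And>g. range g \<subseteq> S \<Longrightarrow> sat S (geval m) (append_env ps g) \<psi> \<longleftrightarrow> R' g"
    using assms unfolding definable_def by blast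
  then show ?thesis unfolding definable_def by (intro exI[of _ "FAnd \<phi> \<psi>"]) simp
qed

lemma definable_imp:
  assumes "definable S m ps R" "definable S m ps R'"
  shows "definable S m ps (\<lambda>g. R g \<longrightarrow> R' g)"
  using definable_not[OF definable_conj[OF assms(1) definable_not[OF assms(2)]]] by simp

lemma definable_subst:
  assumes "definable S m ps R"
  shows "definable S m ps (\<lambda>g. R (\<lambda>i. g (\<pi> i)))"
proof -
  obtain \<phi> where \<phi>: "\<And>g. range g \<subseteq> S \<Longrightarrow> sat S (geval m) (append_env ps g) \<phi> \<longleftrightarrow> R g"
    using assms unfolding definable_def by blast
  define \<rho> where "\<rho> i = (if i < length ps then i else length ps + \<pi> (i - length ps))" for i
  obtain \<psi> where \<psi>: "\<And>g. sat S (geval m) g \<psi> \<longleftrightarrow> sat S (geval m) (\<lambda>i. g (\<rho> i)) \<phi>"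
    using ex_renamed_formula[of S m \<rho> \<phi>] by blast
  have "(\<lambda>i. append_env ps g (\<rho> i)) = append_env ps (\<lambda>i. g (\<pi> i))" for g
    by (auto simp: append_env_def \<rho>_def)
  moreover have "range (\<lambda>i. g (\<pi> i)) \<subseteq> S" if "range g \<subseteq> S" for g using that by blast
  ultimately show ?thesis unfolding definable_def using \<phi> \<psi> by metis
qed

text \<open>In the premise, the bound variable has index 0 and the others are shifted, so that
  no choice of variable names is left when the rule is applied backwards.\<close>

lemma definable_Bex:
  assumes "definable S m ps (\<lambda>g. Q (\<lambda>i. g (Suc i)) (g 0))"
  shows "definable S m ps (\<lambda>g. \<exists>x\<in>S. Q g x)"
proof -
  obtain \<phi> where \<phi>: "\<And>g. range g \<subseteq> S \<Longrightarrow>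
      sat S (geval m) (append_env ps g) \<phi> \<longleftrightarrow> Q (\<lambda>i. g (Suc i)) (g 0)"
    using assms unfolding definable_def by blast
  obtain V where V: "finite V"
    "\<And>g g'. \<forall>i\<in>V. g i = g' i \<Longrightarrow> sat S (geval m) g \<phi> = sat S (geval m) g' \<phi>"
    using finitely_supportedE[OF finitely_supported_sat[of S m \<phi>]] by blast
  define \<pi> where "\<pi> i = (if i < length ps then i else i - 1)" for i
  obtain j where j: "j \<notin> \<pi> ` V" using V(1) ex_new_if_finite infinite_UNIV_nat by blast
  obtain \<psi> where \<psi>: "\<And>g. sat S (geval m) g \<psi> \<longleftrightarrow> sat S (geval m) (\<lambda>i. g ((\<pi>(length ps := j)) i)) \<phi>"
    using ex_renamed_formula[of S m "\<pi>(length ps := j)" \<phi>] by blast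
  have "sat S (geval m) ((append_env ps g)(j := x)) \<psi> \<longleftrightarrow> Q g x" if "range g \<subseteq> S" "x \<in> S" for g x
  proof -
    have "sat S (geval m) ((append_env ps g)(j := x)) \<psi> \<longleftrightarrow>
        sat S (geval m) (append_env ps (case_nat x g)) \<phi>"
      unfolding \<psi>
    proof (intro V(2) ballI)
      fix i assume "i \<in> V"
      then have "\<pi> i \<noteq> j" using j by blast
      then show "((append_env ps g)(j := x)) ((\<pi>(length ps := j)) i) =
          append_env ps (case_nat x g) i"
        by (cases "i = length ps")
          (auto simp: append_env_def \<pi>_def split: nat.split intro!: arg_cong[where f = g])
    qed
    also have "\<dots> \<longleftrightarrow> Q g x" using \<phi>[of "case_nat x g"] that by (force split: nat.splits)
    finally show ?thesis .
  qed
  then have "sat S (geval m) (append_env ps g) (FEx j \<psi>) \<longleftrightarrow> (\<exists>x\<in>S. Q g x)" if "range g \<subseteq> S" for g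
    using that by simp
  then show ?thesis unfolding definable_def by blast
qed

lemma definable_Ball:
  assumes "definable S m ps (\<lambda>g. Q (\<lambda>i. g (Suc i)) (g 0))"
  shows "definable S m ps (\<lambda>g. \<forall>x\<in>S. Q g x)"
  using definable_not[OF definable_Bex[OF definable_not[OF assms]]] by simp

lemma definable_all_less:
  fixes k :: nat
  assumes "\<And>i. definable S m ps (R i)"
  shows "definable S m ps (\<lambda>g. \<forall>i<k. R i g)"
proof (induction k)
  case 0
  have "definable S m ps (\<lambda>g. g 0 = g 0)" by (intro definable_eq definable_term_var)
  then show ?case by simp
next
  case (Suc k)
  have "(\<forall>i<Suc k. R i g) \<longleftrightarrow> R k g \<and> (\<forall>i<k. R i g)" for g by (auto simp: less_Suc_eq)
  then show ?case using definable_conj[OF assms Suc] by simp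
qed

lemmas definable_intros = definable_Bex definable_Ball definable_imp definable_conj definable_eq
  definable_term_var definable_term_param

text \<open>Free variables beyond the first \<open>k\<close> are redirected to an unassigned variable, whose value is
  \<open>e\<close>.\<close>

lemma grp_definable_params_if_definable:
  assumes R: "definable S m ps R" and ps: "set ps \<subseteq> S" and e: "e \<in> S"
  shows "grp_definable_params S m e k {xs. length xs = k \<and> set xs \<subseteq> S \<and> R (env e xs)}"
proof -
  obtain \<phi> where \<phi>: "\<And>g. range g \<subseteq> S \<Longrightarrow> sat S (geval m) (append_env ps g) \<phi> \<longleftrightarrow> R g"
    using R unfolding definable_def by blast
  define \<pi> where "\<pi> i = (if i < length ps then k + i
    else if i - length ps < k then i - length ps else k + length ps)" for i
  obtain \<psi> where \<psi>: "\<And>g. sat S (geval m) g \<psi> \<longleftrightarrow> sat S (geval m) (\<lambda>i. g (\<pi> i)) \<phi>"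
    using ex_renamed_formula[of S m \<pi> \<phi>] by blast
  have "sat S (geval m) (env e (xs @ ps)) \<psi> \<longleftrightarrow> R (env e xs)" if "length xs = k" "set xs \<subseteq> S" for xs
  proof -
    have "(\<lambda>i. env e (xs @ ps) (\<pi> i)) = append_env ps (env e xs)"
      using that(1) by (auto simp: env_def append_env_def \<pi>_def nth_append)
    moreover have "range (env e xs) \<subseteq> S" using that(2) e by (auto simp: env_def)
    ultimately show ?thesis by (simp add: \<phi> \<psi>)
  qed
  then have "{xs. length xs = k \<and> set xs \<subseteq> S \<and> R (env e xs)} =
      {xs. length xs = k \<and> set xs \<subseteq> S \<and> sat S (geval m) (env e (xs @ ps)) \<psi>}" by blast
  then show ?thesis unfolding grp_definable_params_def using ps by blast
qed

section \<open>Arithmetic from addition and divisibility\<close>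

text \<open>Nothing is required of \<open>R\<close> outside the range of \<open>\<tau>\<close>.\<close>

definition definable_via ::
  "'a set \<Rightarrow> ('a \<Rightarrow> 'a \<Rightarrow> 'a) \<Rightarrow> 'a list \<Rightarrow> ('b \<Rightarrow> 'a) \<Rightarrow> ((nat \<Rightarrow> 'b) \<Rightarrow> bool) \<Rightarrow> bool" where
  "definable_via S m ps \<tau> P \<longleftrightarrow> (\<exists>R. definable S m ps R \<and> (\<forall>c. R (\<lambda>i. \<tau> (c i)) \<longleftrightarrow> P c))"

lemma definable_viaI:
  "definable S m ps R \<Longrightarrow> (\<And>c. R (\<lambda>i. \<tau> (c i)) \<longleftrightarrow> P c) \<Longrightarrow> definable_via S m ps \<tau> P"
  unfolding definable_via_def by blast

lemma definable_viaE:
  assumes "definable_via S m ps \<tau> P"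
  obtains R where "definable S m ps R" "\<And>c. R (\<lambda>i. \<tau> (c i)) \<longleftrightarrow> P c"
  using assms unfolding definable_via_def by blast

lemma definable_via_eq:
  assumes "inj \<tau>"
  shows "definable_via S m ps \<tau> (\<lambda>c. c i = c j)"
  by (rule definable_viaI[of _ _ _ "\<lambda>g. g i = g j"])
    (use assms in \<open>simp_all add: inj_eq definable_eq definable_term_var\<close>)

lemma definable_via_not:
  assumes "definable_via S m ps \<tau> P"
  shows "definable_via S m ps \<tau> (\<lambda>c. \<not> P c)"
proof -
  obtain R where "definable S m ps R" "\<And>c. R (\<lambda>i. \<tau> (c i)) \<longleftrightarrow> P c"
    using assms by (rule definable_viaE) blast
  then show ?thesis by (intro definable_viaI[of _ _ _ "\<lambda>g. \<not> R g"] definable_not) simp_all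
qed

lemma definable_via_conj:
  assumes "definable_via S m ps \<tau> P" "definable_via S m ps \<tau> P'"
  shows "definable_via S m ps \<tau> (\<lambda>c. P c \<and> P' c)"
proof -
  obtain R where "definable S m ps R" "\<And>c. R (\<lambda>i. \<tau> (c i)) \<longleftrightarrow> P c"
    using assms(1) by (rule definable_viaE) blast
  moreover obtain R' where "definable S m ps R'" "\<And>c. R' (\<lambda>i. \<tau> (c i)) \<longleftrightarrow> P' c"
    using assms(2) by (rule definable_viaE) blast
  ultimately show ?thesis
    by (intro definable_viaI[of _ _ _ "\<lambda>g. R g \<and> R' g"] definable_conj) simp_all
qed

lemma definable_via_iff:
  assumes "definable_via S m ps \<tau> P" "definable_via S m ps \<tau> P'"
  shows "definable_via S m ps \<tau> (\<lambda>c. P c \<longleftrightarrow> P' c)"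
proof -
  have "definable_via S m ps \<tau> (\<lambda>c. \<not> (P c \<and> \<not> P' c) \<and> \<not> (P' c \<and> \<not> P c))"
    by (intro definable_via_not definable_via_conj assms)
  moreover have "(\<lambda>c. \<not> (P c \<and> \<not> P' c) \<and> \<not> (P' c \<and> \<not> P c)) = (\<lambda>c. P c \<longleftrightarrow> P' c)" by blast
  ultimately show ?thesis by simp
qed

lemma definable_via_subst:
  assumes "definable_via S m ps \<tau> P"
  shows "definable_via S m ps \<tau> (\<lambda>c. P (\<lambda>i. c (\<pi> i)))"
proof -
  obtain R where R: "definable S m ps R" "\<And>c. R (\<lambda>i. \<tau> (c i)) \<longleftrightarrow> P c"
    using assms by (rule definable_viaE) blast
  show ?thesis by (rule definable_viaI[OF definable_subst[OF R(1), of \<pi>]]) (rule R(2))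
qed

lemma definable_via_ex:
  assumes "range \<tau> \<subseteq> S" "definable S m ps (\<lambda>g. g 0 \<in> range \<tau>)"
    and P: "definable_via S m ps \<tau> (\<lambda>c. P (\<lambda>i. c (Suc i)) (c 0))"
  shows "definable_via S m ps \<tau> (\<lambda>c. \<exists>n. P c n)"
proof -
  obtain R where R: "definable S m ps R" "\<And>c. R (\<lambda>i. \<tau> (c i)) \<longleftrightarrow> P (\<lambda>i. c (Suc i)) (c 0)"
    using P by (rule definable_viaE) blast
  have eta: "case_nat (g 0) (\<lambda>i. g (Suc i)) = g" for g :: "nat \<Rightarrow> 'a"
    by (auto split: nat.split)
  show ?thesis
  proof (rule definable_viaI)
    show "definable S m ps (\<lambda>g. \<exists>x\<in>S. x \<in> range \<tau> \<and> R (case_nat x g))"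
      by (rule definable_Bex, rule definable_conj[OF assms(2)]) (simp add: eta R(1))
    fix c :: "nat \<Rightarrow> 'b"
    have "R (case_nat (\<tau> n) (\<lambda>i. \<tau> (c i))) \<longleftrightarrow> P c n" for n
    proof -
      have "case_nat (\<tau> n) (\<lambda>i. \<tau> (c i)) = (\<lambda>i. \<tau> (case_nat n c i))"
        by (auto split: nat.split)
      then show ?thesis using R(2)[of "case_nat n c"] by simp
    qed
    then show "(\<exists>x\<in>S. x \<in> range \<tau> \<and> R (case_nat x (\<lambda>i. \<tau> (c i)))) \<longleftrightarrow> (\<exists>n. P c n)"
      using assms(1) by blast
  qed
qed

text \<open>Successive integers are coprime, so the right-hand side says that \<open>y + x = lcm x (x + 1)\<close>.\<close>

lemma eq_square_iff_dvd:
  fixes x y :: nat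
  shows "y = x * x \<longleftrightarrow> (\<forall>w. y + x dvd w \<longleftrightarrow> x dvd w \<and> x + 1 dvd w)"
proof -
  have "coprime x (x + 1)" by simp
  then have "x dvd w \<and> x + 1 dvd w \<longleftrightarrow> x * (x + 1) dvd w" for w
    by (metis divides_mult dvd_mult_left dvd_mult_right)
  moreover have "(\<forall>w. y + x dvd w \<longleftrightarrow> x * (x + 1) dvd w) \<longleftrightarrow> y + x = x * (x + 1)"
    by (metis dvd_antisym dvd_refl)
  ultimately show ?thesis by auto
qed

lemma eq_mult_iff_squares:
  fixes x y z :: nat
  shows "z = x * y \<longleftrightarrow> (x + y) * (x + y) = x * x + y * y + (z + z)"
  by (auto simp: algebra_simps)

locale add_dvd_coordinates =
  fixes S :: "'a set" and m :: "'a \<Rightarrow> 'a \<Rightarrow> 'a" and e :: 'a and ps :: "'a list" and \<tau> :: "nat \<Rightarrow> 'a"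
  assumes params: "set ps \<subseteq> S"
    and coord_in: "range \<tau> \<subseteq> S"
    and inj_coord: "inj \<tau>"
    and coord_0: "\<tau> 0 = e"
    and coord_add: "\<tau> (i + j) = m (\<tau> i) (\<tau> j)"
    and definable_range: "definable S m ps (\<lambda>g. g 0 \<in> range \<tau>)"
    and definable_dvd: "definable_via S m ps \<tau> (\<lambda>c. c 0 dvd c 1)"
begin

abbreviation nat_definable :: "((nat \<Rightarrow> nat) \<Rightarrow> bool) \<Rightarrow> bool" where
  "nat_definable \<equiv> definable_via S m ps \<tau>"

definition nat_definable_fun :: "((nat \<Rightarrow> nat) \<Rightarrow> nat) \<Rightarrow> bool" where
  "nat_definable_fun f \<longleftrightarrow> nat_definable (\<lambda>c. c 0 = f (\<lambda>i. c (Suc i)))"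

lemmas nat_definable_ex = definable_via_ex[OF coord_in definable_range]

lemma nat_definable_all:
  assumes "nat_definable (\<lambda>c. P (\<lambda>i. c (Suc i)) (c 0))"
  shows "nat_definable (\<lambda>c. \<forall>n. P c n)"
  using definable_via_not[OF nat_definable_ex[OF definable_via_not[OF assms]]] by simp

lemma nat_definable_let:
  assumes "nat_definable_fun f" "nat_definable (\<lambda>c. P (\<lambda>i. c (Suc i)) (c 0))"
  shows "nat_definable (\<lambda>c. P c (f c))"
proof -
  have "nat_definable (\<lambda>c. \<exists>n. n = f c \<and> P c n)"
    using assms unfolding nat_definable_fun_def by (intro nat_definable_ex definable_via_conj)
  then show ?thesis by simp
qed

lemma nat_definable_fun_subst:
  assumes "nat_definable_fun f"
  shows "nat_definable_fun (\<lambda>c. f (\<lambda>i. c (\<pi> i)))"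
  using definable_via_subst[OF assms[unfolded nat_definable_fun_def],
      of "case_nat 0 (\<lambda>i. Suc (\<pi> i))"]
  unfolding nat_definable_fun_def by simp

lemma nat_definable_binary:
  assumes Q: "\<And>i j. nat_definable (\<lambda>c. Q (c i) (c j))"
    and "nat_definable_fun f" "nat_definable_fun f'"
  shows "nat_definable (\<lambda>c. Q (f c) (f' c))"
proof (rule nat_definable_let[OF assms(2)],
    rule nat_definable_let[where f = "\<lambda>c. f' (\<lambda>i. c (Suc i))"])
  show "nat_definable_fun (\<lambda>c. f' (\<lambda>i. c (Suc i)))" by (rule nat_definable_fun_subst[OF assms(3)])
qed (rule Q)

lemma nat_definable_fun_binary:
  assumes q: "\<And>i j k. nat_definable (\<lambda>c. c k = q (c i) (c j))"
    and "nat_definable_fun f" "nat_definable_fun f'"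
  shows "nat_definable_fun (\<lambda>c. q (f c) (f' c))"
  unfolding nat_definable_fun_def
proof (rule nat_definable_let[where P = "\<lambda>c n. c 0 = q n (f' (\<lambda>i. c (Suc i)))"])
  show "nat_definable_fun (\<lambda>c. f (\<lambda>i. c (Suc i)))" by (rule nat_definable_fun_subst[OF assms(2)])
  show "nat_definable (\<lambda>c. c (Suc 0) = q (c 0) (f' (\<lambda>i. c (Suc (Suc i)))))"
  proof (rule nat_definable_let[where P = "\<lambda>c n. c (Suc 0) = q (c 0) n"])
    show "nat_definable_fun (\<lambda>c. f' (\<lambda>i. c (Suc (Suc i))))"
      by (rule nat_definable_fun_subst[OF assms(3)])
    show "nat_definable (\<lambda>c. c (Suc (Suc 0)) = q (c (Suc 0)) (c 0))" by (rule q)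
  qed
qed

lemma nat_definable_fun_var: "nat_definable_fun (\<lambda>c. c i)"
  unfolding nat_definable_fun_def by (rule definable_via_eq[OF inj_coord])

lemma nat_definable_eq:
  "nat_definable_fun f \<Longrightarrow> nat_definable_fun f' \<Longrightarrow> nat_definable (\<lambda>c. f c = f' c)"
  by (rule nat_definable_binary) (rule definable_via_eq[OF inj_coord])

lemma nat_definable_dvd:
  assumes "nat_definable_fun f" "nat_definable_fun f'"
  shows "nat_definable (\<lambda>c. f c dvd f' c)"
proof (rule nat_definable_binary[OF _ assms])
  show "nat_definable (\<lambda>c. c i dvd c j)" for i j
    using definable_via_subst[OF definable_dvd, of "\<lambda>l. if l = 0 then i else j"] by simp
qed

lemma nat_definable_fun_add:
  assumes "nat_definable_fun f" "nat_definable_fun f'"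
  shows "nat_definable_fun (\<lambda>c. f c + f' c)"
proof (rule nat_definable_fun_binary[OF _ assms])
  show "nat_definable (\<lambda>c. c k = c i + c j)" for i j k
  proof (rule definable_viaI)
    show "definable S m ps (\<lambda>g. g k = m (g i) (g j))"
      by (intro definable_eq definable_term_mult definable_term_var)
    show "\<tau> (c k) = m (\<tau> (c i)) (\<tau> (c j)) \<longleftrightarrow> c k = c i + c j" for c
      using inj_coord by (simp add: inj_eq flip: coord_add)
  qed
qed

lemma nat_definable_fun_1: "nat_definable_fun (\<lambda>c. 1)"
proof -
  have "nat_definable (\<lambda>c. \<forall>w. c 0 dvd w)"
    by (intro nat_definable_all nat_definable_dvd nat_definable_fun_var)
  moreover have "(\<forall>w. n dvd w) \<longleftrightarrow> n = 1" for n :: nat by (metis nat_dvd_1_iff_1 one_dvd)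
  ultimately show ?thesis unfolding nat_definable_fun_def by simp
qed

lemma nat_definable_square: "nat_definable (\<lambda>c. c k = c i * c i)"
  unfolding eq_square_iff_dvd
  by (intro nat_definable_all definable_via_iff definable_via_conj nat_definable_dvd
      nat_definable_fun_add nat_definable_fun_var nat_definable_fun_1)

lemma nat_definable_fun_mult:
  assumes "nat_definable_fun f" "nat_definable_fun f'"
  shows "nat_definable_fun (\<lambda>c. f c * f' c)"
proof (rule nat_definable_fun_binary[OF _ assms])
  have square: "nat_definable_fun (\<lambda>c. f c * f c)" if "nat_definable_fun f" for f
    by (rule nat_definable_fun_binary[OF _ that that]) (rule nat_definable_square)
  show "nat_definable (\<lambda>c. c k = c i * c j)" for i j k
    unfolding eq_mult_iff_squares
    by (intro nat_definable_eq nat_definable_fun_add square nat_definable_fun_var)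
qed

lemma nat_definable_fun_aeval: "nat_definable_fun (\<lambda>c. aeval c s)"
  by (induction s)
    (simp_all add: nat_definable_fun_var nat_definable_fun_add nat_definable_fun_mult)

lemma nat_definable_sat: "nat_definable (\<lambda>c. sat UNIV aeval c \<phi>)"
proof (induction \<phi>)
  case (FEq s t)
  show ?case by (simp add: nat_definable_eq nat_definable_fun_aeval)
next
  case (FNot \<phi>)
  then show ?case by (simp add: definable_via_not)
next
  case (FAnd \<phi> \<psi>)
  then show ?case by (simp add: definable_via_conj)
next
  case (FEx i \<phi>)
  have "(\<lambda>j. c (Suc j))(i := c 0) = (\<lambda>j. c (if j = i then 0 else Suc j))" for c :: "nat \<Rightarrow> nat"
    by auto
  then have "nat_definable (\<lambda>c. sat UNIV aeval ((\<lambda>j. c (Suc j))(i := c 0)) \<phi>)"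
    using definable_via_subst[OF FEx, of "\<lambda>j. if j = i then 0 else Suc j"] by simp
  then have "nat_definable (\<lambda>c. \<exists>n. sat UNIV aeval (c(i := n)) \<phi>)" by (rule nat_definable_ex)
  then show ?case by simp
qed

lemma grp_definable_params_coordinates:
  assumes "arith_definable k X"
  shows "grp_definable_params S m e k {map \<tau> ns | ns. ns \<in> X}"
proof -
  obtain \<phi> where X: "X = {ns. length ns = k \<and> sat UNIV aeval (env 0 ns) \<phi>}"
    using assms unfolding arith_definable_def by blast
  obtain R where R: "definable S m ps R" "\<And>c. R (\<lambda>i. \<tau> (c i)) \<longleftrightarrow> sat UNIV aeval c \<phi>"
    using nat_definable_sat by (rule definable_viaE) blast
  have map_coord: "R (env e (map \<tau> ns)) \<longleftrightarrow> sat UNIV aeval (env 0 ns) \<phi>" for ns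
  proof -
    have "env e (map \<tau> ns) = (\<lambda>i. \<tau> (env 0 ns i))" by (auto simp: env_def coord_0)
    then show ?thesis by (simp add: R(2))
  qed
  let ?R = "\<lambda>g. (\<forall>i<k. g i \<in> range \<tau>) \<and> R g"
  have "definable S m ps ?R"
  proof (intro definable_conj definable_all_less R(1))
    show "definable S m ps (\<lambda>g. g i \<in> range \<tau>)" for i
      using definable_subst[OF definable_range, of "\<lambda>_. i"] by simp
  qed
  then have "grp_definable_params S m e k {xs. length xs = k \<and> set xs \<subseteq> S \<and> ?R (env e xs)}"
    using params coord_in coord_0 by (intro grp_definable_params_if_definable) auto
  moreover have "{xs. length xs = k \<and> set xs \<subseteq> S \<and> ?R (env e xs)} = {map \<tau> ns | ns. ns \<in> X}"
  proof (intro equalityI subsetI)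
    fix xs assume xs: "xs \<in> {xs. length xs = k \<and> set xs \<subseteq> S \<and> ?R (env e xs)}"
    then have "\<forall>x\<in>set xs. x \<in> range \<tau>" by (auto simp: env_def all_set_conv_all_nth)
    then obtain ns where ns: "xs = map \<tau> ns" using ex_map_conv[of xs \<tau>] by blast
    then have "ns \<in> X" using xs by (auto simp: X map_coord)
    then show "xs \<in> {map \<tau> ns | ns. ns \<in> X}" using ns by blast
  next
    fix xs assume "xs \<in> {map \<tau> ns | ns. ns \<in> X}"
    then obtain ns where "xs = map \<tau> ns" "ns \<in> X" by blast
    then show "xs \<in> {xs. length xs = k \<and> set xs \<subseteq> S \<and> ?R (env e xs)}"
      using coord_in by (auto simp: X map_coord) (simp add: env_def)
  qed
  ultimately show ?thesis by simp
qed

theorem interprets_arith: "interprets_arith_params S m e"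
proof -
  define D where "D = (\<lambda>x. [x]) ` range \<tau>"
  define f where "f xs = the_inv \<tau> (hd xs)" for xs
  have f_coord: "f [\<tau> n] = n" for n by (simp add: f_def inj_coord the_inv_f_f)
  have preimage: "{concat xss | xss. length xss = k \<and> set xss \<subseteq> D \<and> map f xss \<in> X} =
      {map \<tau> ns | ns. ns \<in> X}"
    if X: "arith_definable k X" for k X
  proof (intro equalityI subsetI)
    fix xs assume "xs \<in> {concat xss | xss. length xss = k \<and> set xss \<subseteq> D \<and> map f xss \<in> X}"
    then obtain xss where xss: "xs = concat xss" "set xss \<subseteq> D" "map f xss \<in> X" by blast
    have "concat xss = map \<tau> (map f xss)" using xss(2) f_coord by (induction xss) (auto simp: D_def)
    then show "xs \<in> {map \<tau> ns | ns. ns \<in> X}" using xss by blast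
  next
    fix xs assume "xs \<in> {map \<tau> ns | ns. ns \<in> X}"
    then obtain ns where ns: "xs = map \<tau> ns" "ns \<in> X" by blast
    have "concat (map (\<lambda>n. [\<tau> n]) ns) = xs" "map f (map (\<lambda>n. [\<tau> n]) ns) = ns"
      using ns f_coord by (simp_all add: comp_def)
    moreover have "length ns = k" using ns X by (auto simp: arith_definable_def)
    ultimately show "xs \<in> {concat xss | xss. length xss = k \<and> set xss \<subseteq> D \<and> map f xss \<in> X}"
      using ns(2) by (intro CollectI exI[of _ "map (\<lambda>n. [\<tau> n]) ns"]) (auto simp: D_def)
  qed
  show ?thesis
    unfolding interprets_arith_params_def
  proof (intro exI conjI allI impI)
    show "D \<subseteq> {xs. length xs = 1 \<and> set xs \<subseteq> S}" using coord_in by (auto simp: D_def)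
    show "f ` D = UNIV" using f_coord by (auto simp: D_def image_image intro!: image_eqI)
    show "grp_definable_params S m e (1 * k)
        {concat xss | xss. length xss = k \<and> set xss \<subseteq> D \<and> map f xss \<in> X}"
      if "arith_definable k X" for k X
      unfolding preimage[OF that] using grp_definable_params_coordinates[OF that] by simp
  qed
qed

end

section \<open>Integer powers of bijections\<close>

definition bij_group :: "('a \<Rightarrow> 'a) monoid" where
  "bij_group = \<lparr>carrier = {f. bij f}, mult = (\<circ>), one = id\<rparr>"

lemma carrier_bij_group [simp]: "f \<in> carrier bij_group \<longleftrightarrow> bij f"
  and mult_bij_group [simp]: "f \<otimes>\<^bsub>bij_group\<^esub> g = f \<circ> g"
  and one_bij_group [simp]: "\<one>\<^bsub>bij_group\<^esub> = id"
  by (simp_all add: bij_group_def)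

lemma group_bij_group: "group bij_group"
proof (rule groupI)
  fix f :: "'a \<Rightarrow> 'a" assume "f \<in> carrier bij_group"
  then have "inv_into UNIV f \<in> carrier bij_group" "inv_into UNIV f \<otimes>\<^bsub>bij_group\<^esub> f = \<one>\<^bsub>bij_group\<^esub>"
    by (simp_all add: bij_imp_bij_inv bij_is_inj)
  then show "\<exists>g\<in>carrier bij_group. g \<otimes>\<^bsub>bij_group\<^esub> f = \<one>\<^bsub>bij_group\<^esub>" by blast
qed (simp_all add: bij_comp comp_assoc)

interpretation bij_group: group bij_group
  by (rule group_bij_group)

lemma inv_bij_group: "bij f \<Longrightarrow> inv\<^bsub>bij_group\<^esub> f = inv_into UNIV f"
  by (rule bij_group.inv_equality) (simp_all add: bij_imp_bij_inv bij_is_inj)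

definition zpow :: "('a \<Rightarrow> 'a) \<Rightarrow> int \<Rightarrow> 'a \<Rightarrow> 'a" where
  "zpow f i = f [^]\<^bsub>bij_group\<^esub> i"

lemma zpow_of_nat [simp]: "zpow f (int n) = f ^^ n"
  unfolding zpow_def int_pow_int
  by (induction n) (simp_all add: funpow_Suc_right del: funpow.simps(2))

lemma zpow_0 [simp]: "zpow f 0 = id"
  by (simp add: zpow_def)

lemma zpow_1 [simp]: "bij f \<Longrightarrow> zpow f 1 = f"
  by (simp add: zpow_def)

lemma bij_zpow: "bij f \<Longrightarrow> bij (zpow f i)"
  using bij_group.int_pow_closed[of f i] by (simp add: zpow_def)

lemma zpow_add: "bij f \<Longrightarrow> zpow f (i + j) = zpow f i \<circ> zpow f j"
  by (simp add: zpow_def bij_group.int_pow_mult)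

lemma zpow_zpow: "bij f \<Longrightarrow> zpow f i (zpow f j x) = zpow f (i + j) x"
  by (simp add: zpow_add)

lemma zpow_neg_of_nat: "bij f \<Longrightarrow> zpow f (- int n) = inv_into UNIV f ^^ n"
  using bij_group.int_pow_neg_int[of f n] bij_group.nat_pow_inv[of f n]
    zpow_of_nat[of "inv_into UNIV f" n]
  by (simp add: zpow_def inv_bij_group int_pow_int)

lemma zpow_closed:
  assumes "bij f" "f \<in> H" "inv_into UNIV f \<in> H" "id \<in> H" "\<And>x y. x \<in> H \<Longrightarrow> y \<in> H \<Longrightarrow> x \<circ> y \<in> H"
  shows "zpow f i \<in> H"
proof -
  have pow: "g ^^ n \<in> H" if "g \<in> H" for g and n :: nat
    using that assms(4,5) by (induction n) simp_all
  show ?thesis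
    by (cases i rule: int_cases2) (use assms(1-3) pow in \<open>simp_all add: zpow_neg_of_nat\<close>)
qed

lemma commute_zpow:
  assumes "bij f" "h \<circ> f = f \<circ> h"
  shows "h \<circ> zpow f i = zpow f i \<circ> h"
proof -
  have "h \<circ> inv_into UNIV f = inv_into UNIV f \<circ> (f \<circ> h) \<circ> inv_into UNIV f"
    using assms(1) by (simp add: bij_is_inj flip: comp_assoc)
  also have "\<dots> = inv_into UNIV f \<circ> h \<circ> (f \<circ> inv_into UNIV f)"
    by (simp only: assms(2)[symmetric] comp_assoc)
  finally have "h \<circ> inv_into UNIV f = inv_into UNIV f \<circ> h"
    using assms(1) surj_iff[of f] by (simp add: bij_is_surj)
  then have "zpow f i \<in> {g. h \<circ> g = g \<circ> h}"
    using assms by (intro zpow_closed) (auto simp: fun_eq_iff)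
  then show ?thesis by simp
qed

definition zconj :: "('a \<Rightarrow> 'a) \<Rightarrow> int \<Rightarrow> ('a \<Rightarrow> 'a) \<Rightarrow> 'a \<Rightarrow> 'a" where
  "zconj f i x = zpow f i \<circ> x \<circ> zpow f (- i)"

lemma zconj_0 [simp]: "zconj f 0 x = x"
  by (simp add: zconj_def)

lemma zconj_id: "bij f \<Longrightarrow> zconj f i id = id"
  by (simp add: zconj_def flip: zpow_add)

lemma zconj_zconj: "bij f \<Longrightarrow> zconj f i (zconj f j x) = zconj f (i + j) x"
  by (simp add: zconj_def fun_eq_iff zpow_zpow add.commute)

lemma zconj_comp: "bij f \<Longrightarrow> zconj f i (x \<circ> y) = zconj f i x \<circ> zconj f i y"
  by (simp add: zconj_def fun_eq_iff zpow_zpow)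

lemma eq_zconj_iff:
  assumes "bij f"
  shows "y = zconj f i x \<longleftrightarrow> y \<circ> zpow f i = zpow f i \<circ> x"
proof
  assume "y \<circ> zpow f i = zpow f i \<circ> x"
  then have "y (zpow f i (zpow f (- i) v)) = zpow f i (x (zpow f (- i) v))" for v
    by (simp add: fun_eq_iff)
  then show "y = zconj f i x" using assms by (simp add: zconj_def fun_eq_iff zpow_zpow)
qed (use assms in \<open>simp add: zconj_def fun_eq_iff zpow_zpow\<close>)

section \<open>Bumps\<close>

definition bump_on :: "('a::linorder \<Rightarrow> 'a) \<Rightarrow> 'a \<Rightarrow> 'a \<Rightarrow> bool" where
  "bump_on x p q \<longleftrightarrow> strict_mono x \<and> surj x \<and>
     (\<forall>y\<in>{p<..<q}. y < x y) \<and> (\<forall>y. y \<notin> {p<..<q} \<longrightarrow> x y = y)"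

lemma bump_on_strict_mono: "bump_on x p q \<Longrightarrow> strict_mono x"
  and bump_on_bij: "bump_on x p q \<Longrightarrow> bij x"
  and bump_on_increases: "bump_on x p q \<Longrightarrow> y \<in> {p<..<q} \<Longrightarrow> y < x y"
  and bump_on_outside: "bump_on x p q \<Longrightarrow> y \<notin> {p<..<q} \<Longrightarrow> x y = y"
  by (simp_all add: bump_on_def bij_def strict_mono_imp_inj_on)

lemma bump_on_fixed_iff: "bump_on x p q \<Longrightarrow> x y = y \<longleftrightarrow> y \<notin> {p<..<q}"
  by (metis bump_on_increases bump_on_outside less_irrefl)

lemma commute_bump_on_mem_iff:
  assumes "bump_on x p q" "inj h" "h \<circ> x = x \<circ> h"
  shows "h y \<in> {p<..<q} \<longleftrightarrow> y \<in> {p<..<q}"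
proof -
  have "x (h y) = h y \<longleftrightarrow> x y = y" using assms(2,3) by (metis comp_apply injD)
  then show ?thesis using bump_on_fixed_iff[OF assms(1)] by blast
qed

lemma bump_on_mem_iff: "bump_on x p q \<Longrightarrow> x y \<in> {p<..<q} \<longleftrightarrow> y \<in> {p<..<q}"
  by (rule commute_bump_on_mem_iff) (auto simp: bump_on_bij bij_is_inj)

lemma bump_on_commute_disjoint:
  assumes x: "bump_on x p q" and y: "bump_on y p' q'" and "q \<le> p'"
  shows "x \<circ> y = y \<circ> x"
proof
  fix z
  consider "z \<in> {p<..<q}" "z \<notin> {p'<..<q'}" | "z \<notin> {p<..<q}" "z \<in> {p'<..<q'}"
    | "z \<notin> {p<..<q}" "z \<notin> {p'<..<q'}"
    using \<open>q \<le> p'\<close> by force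
  then show "(x \<circ> y) z = (y \<circ> x) z"
  proof cases
    case 1
    then have "x z \<in> {p<..<q}" using bump_on_mem_iff[OF x] by blast
    then have "x z \<notin> {p'<..<q'}" using \<open>q \<le> p'\<close> by auto
    then show ?thesis using 1 bump_on_outside[OF y] by simp
  next
    case 2
    then have "y z \<in> {p'<..<q'}" using bump_on_mem_iff[OF y] by blast
    then have "y z \<notin> {p<..<q}" using \<open>q \<le> p'\<close> by auto
    then show ?thesis using 2 bump_on_outside[OF x] by simp
  next
    case 3
    then show ?thesis using bump_on_outside[OF x] bump_on_outside[OF y] by simp
  qed
qed

lemma bump_on_conj:
  fixes f :: "'a::linorder \<Rightarrow> 'b::linorder"
  assumes x: "bump_on x p q" and "strict_mono f" and [simp]: "\<And>y. g (f y) = y" "\<And>y. f (g y) = y"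
  shows "bump_on (f \<circ> x \<circ> g) (f p) (f q)"
proof -
  have less: "f y < f z \<longleftrightarrow> y < z" for y z using \<open>strict_mono f\<close> by (rule strict_mono_less)
  have g_less: "g y < g z \<longleftrightarrow> y < z" for y z using less[of "g y" "g z"] by simp
  have mem: "y \<in> {f p<..<f q} \<longleftrightarrow> g y \<in> {p<..<q}" for y
    using less[of p "g y"] less[of "g y" q] by simp
  show ?thesis
    unfolding bump_on_def
  proof (intro conjI ballI allI impI)
    show "strict_mono (f \<circ> x \<circ> g)"
      using strict_mono_less[OF bump_on_strict_mono[OF x]] less g_less
      by (simp add: strict_mono_def)
    have "surj f" "surj g" using surjI[of f g] surjI[of g f] by simp_all
    then show "surj (f \<circ> x \<circ> g)"
      using bij_is_surj[OF bump_on_bij[OF x]] by (intro comp_surj)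
    show "y < (f \<circ> x \<circ> g) y" if "y \<in> {f p<..<f q}" for y
      using bump_on_increases[OF x that[unfolded mem]] less[of "g y"] by simp
    show "(f \<circ> x \<circ> g) y = y" if "y \<notin> {f p<..<f q}" for y
      using bump_on_outside[OF x that[unfolded mem]] by simp
  qed
qed

lemma bump_on_zpow_strict_mono:
  assumes "bump_on x p q"
  shows "strict_mono (zpow x i)"
proof -
  note bij = bump_on_bij[OF assms]
  have "strict_mono (inv_into UNIV x)"
    by (rule strict_mono_inv[OF bump_on_strict_mono[OF assms] bij_is_surj[OF bij]])
      (rule inv_f_f[OF bij_is_inj[OF bij]])
  moreover have "strict_mono (f \<circ> g)" if "strict_mono f" "strict_mono g" for f g :: "'a \<Rightarrow> 'a"
    using that by (simp add: strict_mono_def)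
  ultimately have "zpow x i \<in> Collect strict_mono"
    using bump_on_strict_mono[OF assms]
    by (intro zpow_closed[OF bij]) (simp_all add: strict_mono_def)
  then show ?thesis by simp
qed

lemma bump_on_zpow_mem_iff:
  assumes "bump_on x p q"
  shows "zpow x i y \<in> {p<..<q} \<longleftrightarrow> y \<in> {p<..<q}"
proof (rule commute_bump_on_mem_iff[OF assms])
  show "inj (zpow x i)" by (intro bij_is_inj bij_zpow bump_on_bij[OF assms])
  show "zpow x i \<circ> x = x \<circ> zpow x i" using commute_zpow[OF bump_on_bij[OF assms], of x i] by simp
qed

lemma bump_on_orbit_strict_mono:
  assumes x: "bump_on x p q" and y: "y \<in> {p<..<q}"
  shows "strict_mono (\<lambda>i. zpow x i y)"
proof (rule strict_monoI)
  have step: "zpow x i y < zpow x (i + 1) y" for i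
  proof -
    have "zpow x (i + 1) y = x (zpow x i y)"
      using zpow_add[of x 1 i] bump_on_bij[OF x] by (simp add: add.commute)
    then show ?thesis using bump_on_increases[OF x] bump_on_zpow_mem_iff[OF x] y by simp
  qed
  fix i j :: int assume "i < j"
  then show "zpow x i y < zpow x j y"
    by (induction j rule: int_gr_induct) (use step in \<open>auto intro: less_trans\<close>)
qed

lemma bump_on_orbit_exceeds:
  fixes x :: "'a::conditionally_complete_linorder \<Rightarrow> 'a"
  assumes x: "bump_on x p q" and y: "y \<in> {p<..<q}" and "z < q"
  shows "\<exists>n::nat. z < (x ^^ n) y"
proof (rule ccontr)
  assume "\<not> ?thesis"
  then have bounded: "(x ^^ n) y \<le> z" for n by (simp add: not_less)
  define s where "s = (SUP n. (x ^^ n) y)"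
  have bdd: "bdd_above (range (\<lambda>n. (x ^^ n) y))" using bounded by (intro bdd_aboveI[of _ z]) auto
  have upper: "(x ^^ n) y \<le> s" for n unfolding s_def using bdd by (rule cSUP_upper2) auto
  have "s \<le> z" unfolding s_def using bounded by (intro cSUP_least) auto
  then have s: "s \<in> {p<..<q}" using upper[of 0] y \<open>z < q\<close> by auto
  obtain w where w: "x w = s" using bump_on_bij[OF x] by (metis bij_pointE)
  then have "w < s" using bump_on_mem_iff[OF x, of w] bump_on_increases[OF x, of w] s by auto
  then obtain n where "w < (x ^^ n) y" unfolding s_def using less_cSUP_iff[OF _ bdd] by auto
  then have "s < (x ^^ Suc n) y"
    using strict_mono_less[OF bump_on_strict_mono[OF x], of w] w by simp
  then show False using upper[of "Suc n"] by simp
qed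

lemma bump_on_orbit_falls_below:
  fixes x :: "'a::conditionally_complete_linorder \<Rightarrow> 'a"
  assumes x: "bump_on x p q" and y: "y \<in> {p<..<q}" and "p < z"
  shows "\<exists>n::nat. zpow x (- int n) y < z"
proof -
  have "min y z \<in> {p<..<q}" using y \<open>p < z\<close> by (simp add: min_less_iff_disj)
  then obtain n where "y < (x ^^ n) (min y z)"
    using bump_on_orbit_exceeds[OF x, of "min y z" y] y by auto
  then have "zpow x (- int n) y < zpow x (- int n) (zpow x (int n) (min y z))"
    using strict_mono_less[OF bump_on_zpow_strict_mono[OF x]] by simp
  also have "\<dots> = min y z"
    using zpow_zpow[OF bump_on_bij[OF x], of "- int n" "int n"] by simp
  finally show ?thesis by auto
qed

section \<open>Affine pieces and slope ratios\<close>

definition affine_on :: "real set \<Rightarrow> (real \<Rightarrow> real) \<Rightarrow> real set \<Rightarrow> bool" where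
  "affine_on \<Lambda> f X \<longleftrightarrow> (\<exists>s\<in>\<Lambda>. \<exists>c. \<forall>y\<in>X. f y = s * y + c)"

lemma affine_onI: "s \<in> \<Lambda> \<Longrightarrow> (\<And>y. y \<in> X \<Longrightarrow> f y = s * y + c) \<Longrightarrow> affine_on \<Lambda> f X"
  unfolding affine_on_def by blast

lemma affine_onE:
  assumes "affine_on \<Lambda> f X"
  obtains s c where "s \<in> \<Lambda>" "\<And>y. y \<in> X \<Longrightarrow> f y = s * y + c"
  using assms unfolding affine_on_def by blast

lemma affine_on_mono: "affine_on \<Lambda> f X \<Longrightarrow> \<Lambda> \<subseteq> \<Lambda>' \<Longrightarrow> Y \<subseteq> X \<Longrightarrow> affine_on \<Lambda>' f Y"
  unfolding affine_on_def by blast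

lemma affine_on_strict_mono_on:
  assumes "affine_on {0<..} f X"
  shows "strict_mono_on X f"
  using assms by (rule affine_onE) (auto intro: strict_mono_onI)

lemma affine_on_fixes:
  assumes aff: "affine_on \<Lambda> f X" and "p \<in> X" "q \<in> X" "p \<noteq> q" "f p = p" "f q = q" and "y \<in> X"
  shows "f y = y"
proof -
  obtain s c where f: "\<And>y. y \<in> X \<Longrightarrow> f y = s * y + c" using aff by (rule affine_onE) blast
  have eq: "s * p + c = p" "s * q + c = q" using f assms by metis+
  then have "(s - 1) * (p - q) = 0" by (simp add: algebra_simps)
  then have "s = 1" using \<open>p \<noteq> q\<close> by simp
  then show ?thesis using f[OF \<open>y \<in> X\<close>] eq by simp
qed

lemma affine_on_invariant_interval_fixes:
  assumes aff: "affine_on {0<..} f {p<..<q}" and "surj f"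
    and invariant: "\<And>y. f y \<in> {p<..<q} \<longleftrightarrow> y \<in> {p<..<q}" and y: "y \<in> {p<..<q}"
  shows "f y = y"
proof -
  obtain s c where s: "0 < s" and f: "\<And>y. y \<in> {p<..<q} \<Longrightarrow> f y = s * y + c"
    using aff by (rule affine_onE) auto
  have "p < q" using y by simp
  have "{s * p + c<..<s * q + c} = {p<..<q}"
  proof (intro equalityI subsetI)
    fix z assume "z \<in> {s * p + c<..<s * q + c}"
    then have "(z - c) / s \<in> {p<..<q}" using s by (simp add: field_simps)
    then have "f ((z - c) / s) \<in> {p<..<q}" "f ((z - c) / s) = s * ((z - c) / s) + c"
      using invariant f by blast+
    then show "z \<in> {p<..<q}" using s by simp
  next
    fix z assume z: "z \<in> {p<..<q}"
    obtain w where "f w = z" using \<open>surj f\<close> by (metis surjD)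
    then show "z \<in> {s * p + c<..<s * q + c}" using z invariant[of w] f[of w] s by auto
  qed
  moreover have "s * p + c < s * q + c" using \<open>p < q\<close> s by simp
  ultimately have "s * p + c = p" "s * q + c = q"
    using \<open>p < q\<close> cInf_greaterThanLessThan cSup_greaterThanLessThan by metis+
  moreover have "affine_on {s} (\<lambda>y. s * y + c) UNIV" by (rule affine_onI) simp_all
  ultimately show ?thesis
    using affine_on_fixes[of "{s}" "\<lambda>y. s * y + c" UNIV p q y] \<open>p < q\<close> f[OF y] by simp
qed

text \<open>The left slope at \<open>x\<close> is \<open>s\<close>, the right slope \<open>\<rho> * s\<close>. Unlike the slopes, \<open>\<rho>\<close> is \<open>1\<close>
  on every affine piece.\<close>

definition slope_ratio :: "(real \<Rightarrow> real) \<Rightarrow> real \<Rightarrow> real \<Rightarrow> bool" where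
  "slope_ratio f x \<rho> \<longleftrightarrow> (\<exists>\<delta>>0. \<exists>s>0. \<forall>v\<in>{0<..<\<delta>}.
     f (x + v) = f x + \<rho> * s * v \<and> f (x - v) = f x - s * v)"

lemma slope_ratioE:
  assumes "slope_ratio f x \<rho>"
  obtains \<delta> s where "0 < \<delta>" "0 < s" "\<And>v. 0 < v \<Longrightarrow> v < \<delta> \<Longrightarrow> f (x + v) = f x + \<rho> * s * v"
    "\<And>v. 0 < v \<Longrightarrow> v < \<delta> \<Longrightarrow> f (x - v) = f x - s * v"
  using assms unfolding slope_ratio_def Ball_def greaterThanLessThan_iff by blast

lemma slope_ratio_unique:
  assumes "slope_ratio f x \<rho>" "slope_ratio f x \<sigma>"
  shows "\<rho> = \<sigma>"
proof -
  obtain \<delta> s where \<rho>: "0 < \<delta>" "0 < s" "\<And>v. 0 < v \<Longrightarrow> v < \<delta> \<Longrightarrow> f (x + v) = f x + \<rho> * s * v"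
    "\<And>v. 0 < v \<Longrightarrow> v < \<delta> \<Longrightarrow> f (x - v) = f x - s * v"
    using assms(1) by (rule slope_ratioE) blast
  obtain \<delta>' s' where \<sigma>: "0 < \<delta>'" "0 < s'" "\<And>v. 0 < v \<Longrightarrow> v < \<delta>' \<Longrightarrow> f (x + v) = f x + \<sigma> * s' * v"
    "\<And>v. 0 < v \<Longrightarrow> v < \<delta>' \<Longrightarrow> f (x - v) = f x - s' * v"
    using assms(2) by (rule slope_ratioE) blast
  define v where "v = min \<delta> \<delta>' / 2"
  have v: "0 < v" "v < \<delta>" "v < \<delta>'" using \<rho>(1) \<sigma>(1) by (auto simp: v_def)
  have "s * v = s' * v" "\<rho> * s * v = \<sigma> * s' * v" using \<rho>(3,4)[of v] \<sigma>(3,4)[of v] v by auto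
  then show ?thesis using v \<rho>(2) by auto
qed

lemma slope_ratio_comp:
  assumes "slope_ratio f x \<rho>" "slope_ratio g (f x) \<sigma>" "0 < \<rho>"
  shows "slope_ratio (g \<circ> f) x (\<rho> * \<sigma>)"
proof -
  obtain \<delta> s where f: "0 < \<delta>" "0 < s" "\<And>v. 0 < v \<Longrightarrow> v < \<delta> \<Longrightarrow> f (x + v) = f x + \<rho> * s * v"
    "\<And>v. 0 < v \<Longrightarrow> v < \<delta> \<Longrightarrow> f (x - v) = f x - s * v"
    using assms(1) by (rule slope_ratioE) blast
  obtain \<delta>' s' where g: "0 < \<delta>'" "0 < s'"
    "\<And>v. 0 < v \<Longrightarrow> v < \<delta>' \<Longrightarrow> g (f x + v) = g (f x) + \<sigma> * s' * v"
    "\<And>v. 0 < v \<Longrightarrow> v < \<delta>' \<Longrightarrow> g (f x - v) = g (f x) - s' * v"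
    using assms(2) by (rule slope_ratioE) blast
  define d where "d = min \<delta> (min (\<delta>' / s) (\<delta>' / (\<rho> * s)))"
  have d: "0 < d" "v < d \<Longrightarrow> v < \<delta>" "v < d \<Longrightarrow> s * v < \<delta>'" "v < d \<Longrightarrow> \<rho> * s * v < \<delta>'" for v
    using f(1,2) g(1) \<open>0 < \<rho>\<close> by (auto simp: d_def field_simps)
  have "(g \<circ> f) (x + v) = (g \<circ> f) x + \<rho> * \<sigma> * (s * s') * v \<and>
      (g \<circ> f) (x - v) = (g \<circ> f) x - s * s' * v"
    if v: "v \<in> {0<..<d}" for v
  proof -
    have "0 < s * v" "0 < \<rho> * s * v" using v f(2) \<open>0 < \<rho>\<close> by auto
    then show ?thesis using f(3,4)[of v] g(4)[of "s * v"] g(3)[of "\<rho> * s * v"] v d by simp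
  qed
  moreover have "0 < s * s'" using f(2) g(2) by simp
  ultimately show ?thesis unfolding slope_ratio_def using d(1) by blast
qed

lemma slope_ratio_affine_pieces:
  assumes "affine_on {s} f {a..x}" "affine_on {s'} f {x..b}" and "a < x" "x < b" "0 < s"
  shows "slope_ratio f x (s' / s)"
proof -
  obtain c where left: "\<And>y. y \<in> {a..x} \<Longrightarrow> f y = s * y + c"
    using assms(1) by (rule affine_onE) blast
  obtain c' where right: "\<And>y. y \<in> {x..b} \<Longrightarrow> f y = s' * y + c'"
    using assms(2) by (rule affine_onE) blast
  have "f (x + v) = f x + s' / s * s * v \<and> f (x - v) = f x - s * v"
    if "v \<in> {0<..<min (x - a) (b - x)}" for v
    using that left[of x] left[of "x - v"] right[of x] right[of "x + v"] \<open>0 < s\<close>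
    by (simp add: algebra_simps)
  moreover have "0 < min (x - a) (b - x)" using assms(3,4) by simp
  ultimately show ?thesis unfolding slope_ratio_def using \<open>0 < s\<close> by blast
qed

lemma slope_ratio_affine:
  assumes "affine_on {0<..} f {a<..<b}" "x \<in> {a<..<b}"
  shows "slope_ratio f x 1"
proof -
  obtain s c where s: "0 < s" "\<And>y. y \<in> {a<..<b} \<Longrightarrow> f y = s * y + c"
    using assms(1) by (rule affine_onE) auto
  have "affine_on {s} f {(a + x) / 2..x}" "affine_on {s} f {x..(x + b) / 2}"
    using assms(2) by (auto intro!: affine_onI s(2))
  then show ?thesis
    using slope_ratio_affine_pieces[of s f "(a + x) / 2" x s "(x + b) / 2"] s(1) assms(2) by simp
qed

lemma slope_ratio_funpow:
  assumes "\<And>y. y \<in> I \<Longrightarrow> f y \<in> I \<and> slope_ratio f y (\<rho> y)" "\<And>y. 0 < \<rho> y" "y \<in> I"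
  shows "slope_ratio (f ^^ n) y (\<Prod>i<n. \<rho> ((f ^^ i) y))"
proof (induction n)
  case 0
  show ?case
    unfolding slope_ratio_def by (intro exI[of _ "1::real"] conjI ballI) simp_all
next
  case (Suc n)
  have "(f ^^ n) y \<in> I" by (induction n) (use assms in auto)
  then have "slope_ratio (f \<circ> f ^^ n) y ((\<Prod>i<n. \<rho> ((f ^^ i) y)) * \<rho> ((f ^^ n) y))"
    using Suc assms(1,2) by (intro slope_ratio_comp) (auto intro: prod_pos)
  then show ?case by (simp add: comp_def)
qed

section \<open>Three-piece bumps\<close>

lemma strict_mono_on_glue:
  fixes f :: "'a::linorder \<Rightarrow> 'b::order"
  assumes "strict_mono_on A f" "strict_mono_on B f" and c: "c \<in> A" "c \<in> B"
    and sides: "A \<subseteq> {..c}" "B \<subseteq> {c..}"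
    and cover: "C \<subseteq> A \<union> B"
  shows "strict_mono_on C f"
proof (rule strict_mono_onI)
  fix x y assume "x \<in> C" "y \<in> C" "x < y"
  have mono_A: "u < v \<Longrightarrow> f u < f v" if "u \<in> A" "v \<in> A" for u v
    using strict_mono_onD[OF assms(1)] that by blast
  have mono_B: "u < v \<Longrightarrow> f u < f v" if "u \<in> B" "v \<in> B" for u v
    using strict_mono_onD[OF assms(2)] that by blast
  show "f x < f y"
  proof (cases "x \<in> A \<and> y \<in> A \<or> x \<in> B \<and> y \<in> B")
    case True
    then show ?thesis using mono_A mono_B \<open>x < y\<close> by blast
  next
    case False
    have "\<not> (x \<in> B \<and> y \<in> A)"
      using sides \<open>x < y\<close> by (meson atLeast_iff atMost_iff in_mono leD order_trans)
    then have "x \<in> A" "y \<in> B" "x \<noteq> c" "y \<noteq> c"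
      using False cover \<open>x \<in> C\<close> \<open>y \<in> C\<close> c by blast+
    moreover from this have "x < c" "c < y" using sides by (auto simp: less_le)
    ultimately have "f x < f c" "f c < f y" using mono_A mono_B c by simp_all
    then show ?thesis by simp
  qed
qed

definition three_piece_map :: "real \<Rightarrow> real \<Rightarrow> real \<Rightarrow> real \<Rightarrow> real \<Rightarrow> real \<Rightarrow> real \<Rightarrow> real" where
  "three_piece_map p q d1 d2 \<alpha> \<beta> y =
     (if y < p \<or> q \<le> y then y
      else if y < p + d1 then p + \<alpha> * (y - p)
      else if y < q - d2 then y + (\<alpha> - 1) * d1
      else q - \<beta> * (q - y))"

text \<open>By \<open>shift\<close>, the displacements at the two ends of the middle piece agree, so it is a
  translation.\<close>

locale three_pieces =
  fixes p q d1 d2 \<alpha> \<beta> :: real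
  assumes lengths_pos: "0 < d1" "0 < d2" and slopes_pos: "0 < \<alpha>" "0 < \<beta>"
    and fit: "p + d1 \<le> q - d2" and shift: "(\<alpha> - 1) * d1 = (1 - \<beta>) * d2"
begin

abbreviation \<phi> :: "real \<Rightarrow> real" where
  "\<phi> \<equiv> three_piece_map p q d1 d2 \<alpha> \<beta>"

lemma outside_piece: "y \<notin> {p<..<q} \<Longrightarrow> \<phi> y = y"
  and right_piece: "y \<in> {q - d2..q} \<Longrightarrow> \<phi> y = q - \<beta> * (q - y)"
  and middle_piece: "y \<in> {p + d1..q - d2} \<Longrightarrow> \<phi> y = y + (\<alpha> - 1) * d1"
  using lengths_pos fit shift by (auto simp: three_piece_map_def algebra_simps)

lemma left_piece:
  assumes "y \<in> {p..p + d1}"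
  shows "\<phi> y = p + \<alpha> * (y - p)"
proof (cases "y = p + d1")
  case True
  then show ?thesis using middle_piece[of y] fit by (simp add: algebra_simps)
next
  case False
  then show ?thesis using assms lengths_pos fit by (simp add: three_piece_map_def)
qed

lemma affine_on_pieces:
  "affine_on {1} \<phi> {..p}" "affine_on {\<alpha>} \<phi> {p..p + d1}" "affine_on {1} \<phi> {p + d1..q - d2}"
  "affine_on {\<beta>} \<phi> {q - d2..q}" "affine_on {1} \<phi> {q..}"
proof -
  show "affine_on {1} \<phi> {..p}" "affine_on {1} \<phi> {q..}"
    by (rule affine_onI[where s = 1 and c = 0], simp, simp add: outside_piece)+
  show "affine_on {\<alpha>} \<phi> {p..p + d1}"
    by (rule affine_onI[where s = \<alpha> and c = "p - \<alpha> * p"]) (simp_all add: left_piece algebra_simps)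
  show "affine_on {1} \<phi> {p + d1..q - d2}"
    by (rule affine_onI[where s = 1 and c = "(\<alpha> - 1) * d1"]) (simp_all add: middle_piece)
  show "affine_on {\<beta>} \<phi> {q - d2..q}"
    by (rule affine_onI[where s = \<beta> and c = "q - \<beta> * q"]) (simp_all add: right_piece algebra_simps)
qed

lemma strict_mono_three_piece_map: "strict_mono \<phi>"
proof -
  have piece: "strict_mono_on X \<phi>" if "affine_on {s} \<phi> X" "0 < s" for s X
    using that by (intro affine_on_strict_mono_on affine_on_mono[OF that(1)]) simp_all
  note pieces = piece[OF affine_on_pieces(1)] piece[OF affine_on_pieces(2)]
    piece[OF affine_on_pieces(3)] piece[OF affine_on_pieces(4)] piece[OF affine_on_pieces(5)]
  have "strict_mono_on {..p + d1} \<phi>"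
    by (rule strict_mono_on_glue[OF pieces(1,2), of p]) (use lengths_pos slopes_pos in auto)
  then have "strict_mono_on {..q - d2} \<phi>"
    by (rule strict_mono_on_glue[OF _ pieces(3), of _ "p + d1"]) (use fit in auto)
  then have "strict_mono_on {..q} \<phi>"
    by (rule strict_mono_on_glue[OF _ pieces(4), of _ "q - d2"])
      (use lengths_pos slopes_pos in auto)
  then show ?thesis
    by (rule strict_mono_on_glue[OF _ pieces(5), of _ q]) auto
qed

lemma three_pieces_inverse: "three_pieces p q (\<alpha> * d1) (\<beta> * d2) (1 / \<alpha>) (1 / \<beta>)"
  using lengths_pos slopes_pos fit shift by unfold_locales (simp_all add: algebra_simps)

lemma three_piece_map_inverse: "three_piece_map p q (\<alpha> * d1) (\<beta> * d2) (1 / \<alpha>) (1 / \<beta>) (\<phi> y) = y"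
proof -
  interpret inverse: three_pieces p q "\<alpha> * d1" "\<beta> * d2" "1 / \<alpha>" "1 / \<beta>"
    by (rule three_pieces_inverse)
  consider "y \<notin> {p<..<q}" | "y \<in> {p..p + d1}" | "y \<in> {p + d1..q - d2}" | "y \<in> {q - d2..q}"
    by force
  then show ?thesis
  proof cases
    case 1
    then show ?thesis by (simp add: outside_piece inverse.outside_piece)
  next
    case 2
    then have "\<phi> y \<in> {p..p + \<alpha> * d1}" using slopes_pos by (simp add: left_piece)
    then show ?thesis using 2 slopes_pos by (simp add: left_piece inverse.left_piece)
  next
    case 3
    then have "\<phi> y \<in> {p + \<alpha> * d1..q - \<beta> * d2}" using shift by (simp add: middle_piece algebra_simps)
    then have "\<phi> y + (1 / \<alpha> - 1) * (\<alpha> * d1) =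
        three_piece_map p q (\<alpha> * d1) (\<beta> * d2) (1 / \<alpha>) (1 / \<beta>) (\<phi> y)"
      by (simp only: inverse.middle_piece)
    then show ?thesis using 3 slopes_pos by (simp add: middle_piece algebra_simps)
  next
    case 4
    then have "\<phi> y \<in> {q - \<beta> * d2..q}" using slopes_pos by (simp add: right_piece)
    then show ?thesis using 4 slopes_pos by (simp add: right_piece inverse.right_piece)
  qed
qed

lemma three_piece_map_inverse_right:
  "\<phi> (three_piece_map p q (\<alpha> * d1) (\<beta> * d2) (1 / \<alpha>) (1 / \<beta>) y) = y"
  using three_pieces.three_piece_map_inverse[OF three_pieces_inverse, of y] slopes_pos by simp

lemma surj_three_piece_map: "surj \<phi>"
  using three_piece_map_inverse_right by (rule surjI)

lemma inv_three_piece_map: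
  "inv_into UNIV \<phi> = three_piece_map p q (\<alpha> * d1) (\<beta> * d2) (1 / \<alpha>) (1 / \<beta>)"
  using three_piece_map_inverse three_piece_map_inverse_right by (intro inv_equality)

lemma bump_on_three_piece_map:
  assumes "1 < \<alpha>"
  shows "bump_on \<phi> p q"
proof -
  have "0 < (\<alpha> - 1) * d1" using lengths_pos assms by simp
  then have "\<beta> < 1" using lengths_pos by (simp add: shift zero_less_mult_iff)
  have "y < \<phi> y" if y: "y \<in> {p<..<q}" for y
  proof -
    consider "y \<in> {p..p + d1}" | "y \<in> {p + d1..q - d2}" | "y \<in> {q - d2..q}" using y by force
    then show ?thesis
    proof cases
      case 1
      have "1 * (y - p) < \<alpha> * (y - p)" using y assms by (intro mult_strict_right_mono) auto
      then show ?thesis using 1 by (simp add: left_piece)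
    next
      case 2
      then show ?thesis using \<open>0 < (\<alpha> - 1) * d1\<close> by (simp add: middle_piece)
    next
      case 3
      have "\<beta> * (q - y) < 1 * (q - y)" using y \<open>\<beta> < 1\<close> by (intro mult_strict_right_mono) auto
      then show ?thesis using 3 by (simp add: right_piece)
    qed
  qed
  then show ?thesis
    unfolding bump_on_def using strict_mono_three_piece_map surj_three_piece_map outside_piece
    by blast
qed

definition kink :: "real \<Rightarrow> real" where
  "kink y = (if y = p + d1 then 1 / \<alpha> else if y = q - d2 then \<beta> else 1)"

lemma slope_ratio_kink:
  assumes y: "y \<in> {p<..<q}" and gap: "p + d1 < q - d2"
  shows "slope_ratio \<phi> y (kink y)"
proof -
  have inner: "slope_ratio \<phi> y 1" if "affine_on {s} \<phi> {a..b}" "0 < s" "a < y" "y < b" for s a b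
  proof (rule slope_ratio_affine)
    show "affine_on {0<..} \<phi> {a<..<b}" by (rule affine_on_mono[OF that(1)]) (use that(2) in auto)
    show "y \<in> {a<..<b}" using that(3,4) by simp
  qed
  have "p < y" "y < q" using y by simp_all
  consider "y < p + d1" | "y = p + d1" | "p + d1 < y" "y < q - d2" | "y = q - d2" | "q - d2 < y"
    using less_linear[of y "p + d1"] less_linear[of y "q - d2"] by blast
  then show ?thesis
  proof cases
    case 1
    then show ?thesis
      using inner[OF affine_on_pieces(2) slopes_pos(1) \<open>p < y\<close>] gap by (simp add: kink_def)
  next
    case 2
    then show ?thesis
      using slope_ratio_affine_pieces[OF affine_on_pieces(2,3)] lengths_pos slopes_pos gap
      by (simp add: kink_def)
  next
    case 3
    then show ?thesis using inner[OF affine_on_pieces(3)] by (simp add: kink_def)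
  next
    case 4
    then show ?thesis
      using slope_ratio_affine_pieces[OF affine_on_pieces(3,4)] lengths_pos gap
      by (simp add: kink_def)
  next
    case 5
    then show ?thesis
      using inner[OF affine_on_pieces(4) slopes_pos(2) _ \<open>y < q\<close>] gap by (simp add: kink_def)
  qed
qed

end

section \<open>The centralizer of a three-piece bump\<close>

locale end_affine_group =
  fixes G :: "(real \<Rightarrow> real) set" and r :: real
  assumes r_pos: "0 < r"
    and id_in: "id \<in> G"
    and comp_in: "x \<in> G \<Longrightarrow> y \<in> G \<Longrightarrow> x \<circ> y \<in> G"
    and bij_in: "x \<in> G \<Longrightarrow> bij x"
    and outside_in: "x \<in> G \<Longrightarrow> v \<notin> {0..<r} \<Longrightarrow> x v = v"
    and affine_near_0: "x \<in> G \<Longrightarrow> \<exists>\<epsilon>>0. affine_on {0<..} x {0..<\<epsilon>}"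
    and affine_near_r: "x \<in> G \<Longrightarrow> \<exists>\<epsilon><r. affine_on {0<..} x {\<epsilon><..<r}"

locale end_affine_group_bump = end_affine_group G r for G r +
  fixes t :: "real \<Rightarrow> real"
  assumes t_in: "t \<in> G" and inv_t_in: "inv_into UNIV t \<in> G" and bump_t: "bump_on t 0 r"
begin

lemma bij_t: "bij t"
  by (rule bij_in[OF t_in])

lemma zpow_in: "zpow t i \<in> G"
  by (rule zpow_closed[OF bij_t t_in inv_t_in id_in comp_in])

lemma eq_id_if_commute_fixes:
  assumes h: "h \<in> G" "h \<circ> t = t \<circ> h" and y: "y \<in> {0<..<r}" "h y = y"
  shows "h = id"
proof -
  have comm: "h (zpow t i z) = zpow t i (h z)" for i z
    using commute_zpow[OF bij_t h(2), of i] by (metis comp_apply)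
  obtain \<epsilon> where \<epsilon>: "0 < \<epsilon>" "affine_on {0<..} h {0..<\<epsilon>}" using affine_near_0[OF h(1)] by blast
  obtain n where n: "zpow t (- int n) y < \<epsilon>"
    using bump_on_orbit_falls_below[OF bump_t y(1) \<epsilon>(1)] by blast
  define p p' where "p = zpow t (- int n) y" and "p' = zpow t (- int n - 1) y"
  have p: "0 < p'" "p' < p" "p < \<epsilon>"
    using bump_on_zpow_mem_iff[OF bump_t, of "- int n - 1" y]
      strict_mono_less[OF bump_on_orbit_strict_mono[OF bump_t y(1)], of "- int n - 1" "- int n"]
      y(1) n
    by (simp_all add: p_def p'_def)
  have "h p = p" "h p' = p'" by (simp_all add: p_def p'_def comm y(2))
  then have near: "h z = z" if "z \<in> {0..<\<epsilon>}" for z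
    using affine_on_fixes[OF \<epsilon>(2), of p p' z] p that by auto
  have "h z = z" for z
  proof (cases "z \<in> {0<..<r}")
    case True
    then obtain k where k: "zpow t (- int k) z < \<epsilon>"
      using bump_on_orbit_falls_below[OF bump_t _ \<epsilon>(1)] by blast
    have "zpow t (- int k) z \<in> {0<..<r}" using True bump_on_zpow_mem_iff[OF bump_t] by blast
    then have "zpow t (- int k) (h z) = zpow t (- int k) z" using near k by (simp flip: comm)
    then show ?thesis using bij_zpow[OF bij_t, of "- int k"] by (metis bij_is_inj injD)
  next
    case False
    then show ?thesis using near[of z] outside_in[OF h(1), of z] \<epsilon>(1) by (cases "z = 0") auto
  qed
  then show ?thesis by auto
qed

lemma eq_zpow_if_commute:
  assumes h: "h \<in> G" "h \<circ> t = t \<circ> h" and y: "y \<in> {0<..<r}" "h y = zpow t i y"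
  shows "h = zpow t i"
proof -
  have "zpow t (- i) \<circ> h = id"
  proof (rule eq_id_if_commute_fixes)
    show "zpow t (- i) \<circ> h \<in> G" by (rule comp_in[OF zpow_in h(1)])
    show "zpow t (- i) \<circ> h \<circ> t = t \<circ> (zpow t (- i) \<circ> h)"
      using h(2) commute_zpow[OF bij_t refl, of "- i"] by (metis comp_assoc)
    show "(zpow t (- i) \<circ> h) y = y" using y(2) by (simp add: zpow_zpow[OF bij_t])
  qed (rule y(1))
  then have "zpow t i \<circ> (zpow t (- i) \<circ> h) = zpow t i" by simp
  then show ?thesis by (simp add: fun_eq_iff zpow_zpow[OF bij_t])
qed

lemma ex_smooth_orbit_ends:
  assumes h: "h \<in> G" and y: "y \<in> {0<..<r}"
  shows "\<exists>k n. k < n \<and> slope_ratio h (zpow t (- int k) y) 1 \<and>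
    slope_ratio h ((t ^^ n) (zpow t (- int k) y)) 1"
proof -
  have orbit: "zpow t i y \<in> {0<..<r}" for i using bump_on_zpow_mem_iff[OF bump_t] y by blast
  obtain \<epsilon> where \<epsilon>: "0 < \<epsilon>" "affine_on {0<..} h {0..<\<epsilon>}" using affine_near_0[OF h] by blast
  obtain k where k: "zpow t (- int k) y < \<epsilon>"
    using bump_on_orbit_falls_below[OF bump_t y \<epsilon>(1)] by blast
  have "affine_on {0<..} h {0<..<\<epsilon>}" by (rule affine_on_mono[OF \<epsilon>(2)]) auto
  then have "slope_ratio h (zpow t (- int k) y) 1"
    by (rule slope_ratio_affine) (use k orbit[of "- int k"] in simp)
  moreover obtain \<epsilon>' where \<epsilon>': "\<epsilon>' < r" "affine_on {0<..} h {\<epsilon>'<..<r}"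
    using affine_near_r[OF h] by blast
  have "t y \<in> {0<..<r}" using bump_on_mem_iff[OF bump_t] y by blast
  then obtain m where m: "\<epsilon>' < (t ^^ m) (t y)"
    using bump_on_orbit_exceeds[OF bump_t _ \<epsilon>'(1)] by blast
  have "int (k + Suc m) + - int k = int (Suc m)" by simp
  then have end_eq: "(t ^^ (k + Suc m)) (zpow t (- int k) y) = (t ^^ Suc m) y"
    using zpow_zpow[OF bij_t, of "int (k + Suc m)" "- int k" y] by (simp only: zpow_of_nat)
  have "(t ^^ Suc m) y \<in> {\<epsilon>'<..<r}"
    using m orbit[of "int (Suc m)", unfolded zpow_of_nat] by (simp add: funpow_swap1)
  then have "slope_ratio h ((t ^^ (k + Suc m)) (zpow t (- int k) y)) 1"
    unfolding end_eq by (rule slope_ratio_affine[OF \<epsilon>'(2)])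
  ultimately show ?thesis by (intro exI[of _ k] exI[of _ "k + Suc m"]) simp
qed

end

text \<open>The slope ratios at the kinks of \<open>t\<close> are \<open>1 / \<alpha> < \<beta> < 1\<close>, so the product of the slope ratios
  along an orbit tells the orbit of the first kink from all others. An element of \<open>G\<close> that commutes
  with \<open>t\<close> preserves these products, as it is affine near both ends of a long orbit segment.\<close>

locale end_affine_group_three_pieces =
  three_pieces 0 r d1 d2 \<alpha> \<beta> + end_affine_group_bump G r "three_piece_map 0 r d1 d2 \<alpha> \<beta>"
  for G r d1 d2 \<alpha> \<beta> +
  assumes gap: "d1 < r - d2" and kinks: "1 / \<alpha> < \<beta>" "\<beta> < 1"
begin

lemma kink_bounds: "0 < kink y" "kink y \<le> 1"
  using slopes_pos kinks less_trans[OF kinks] unfolding kink_def by auto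

lemma slope_ratio_orbit:
  assumes "y \<in> {0<..<r}"
  shows "slope_ratio (\<phi> ^^ n) y (\<Prod>i<n. kink ((\<phi> ^^ i) y))"
  using assms gap kink_bounds(1) bump_on_mem_iff[OF bump_t]
  by (intro slope_ratio_funpow[where I = "{0<..<r}"] conjI slope_ratio_kink) auto

lemma orbit_kink_prod_commute:
  assumes h: "h \<in> G" "h \<circ> \<phi> = \<phi> \<circ> h" and y: "y \<in> {0<..<r}"
    and smooth: "slope_ratio h y 1" "slope_ratio h ((\<phi> ^^ n) y) 1"
  shows "(\<Prod>i<n. kink ((\<phi> ^^ i) (h y))) = (\<Prod>i<n. kink ((\<phi> ^^ i) y))"
proof -
  have h_y_in: "h y \<in> {0<..<r}"
    using commute_bump_on_mem_iff[OF bump_t _ h(2)] bij_is_inj[OF bij_in[OF h(1)]] y by blast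
  have "slope_ratio (h \<circ> \<phi> ^^ n) y ((\<Prod>i<n. kink ((\<phi> ^^ i) y)) * 1)"
    using kink_bounds(1) by (intro slope_ratio_comp slope_ratio_orbit y smooth(2) prod_pos)
  moreover have "slope_ratio (\<phi> ^^ n \<circ> h) y (1 * (\<Prod>i<n. kink ((\<phi> ^^ i) (h y))))"
    by (intro slope_ratio_comp slope_ratio_orbit h_y_in smooth(1)) simp
  moreover have "h \<circ> \<phi> ^^ n = \<phi> ^^ n \<circ> h" using commute_zpow[OF bij_t h(2), of "int n"] by simp
  ultimately show ?thesis using slope_ratio_unique by fastforce
qed

lemma orbit_kink_prod_le:
  assumes "k < n" "(\<phi> ^^ k) y = d1"
  shows "(\<Prod>i<n. kink ((\<phi> ^^ i) y)) \<le> 1 / \<alpha>"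
proof -
  have "(\<Prod>i<n. kink ((\<phi> ^^ i) y)) = kink d1 * (\<Prod>i\<in>{..<n} - {k}. kink ((\<phi> ^^ i) y))"
    using assms by (simp add: prod.remove)
  also have "\<dots> \<le> kink d1 * 1"
    using kink_bounds by (intro mult_left_mono prod_le_1) (auto intro: less_imp_le)
  finally show ?thesis by (simp add: kink_def)
qed

lemma orbit_kink_prod_ge:
  assumes y: "y \<in> {0<..<r}" and avoids: "\<And>i. i < n \<Longrightarrow> (\<phi> ^^ i) y \<noteq> d1"
  shows "\<beta> \<le> (\<Prod>i<n. kink ((\<phi> ^^ i) y))"
proof (cases "\<exists>m<n. (\<phi> ^^ m) y = r - d2")
  case True
  then obtain m where m: "m < n" "(\<phi> ^^ m) y = r - d2" by blast
  have "(\<phi> ^^ i) y = r - d2 \<longleftrightarrow> i = m" for i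
    using strict_mono_eq[OF bump_on_orbit_strict_mono[OF bump_t y], of "int i" "int m"] m(2) by simp
  then have "(\<Prod>i<n. kink ((\<phi> ^^ i) y)) = (\<Prod>i<n. if i = m then \<beta> else 1)"
    using avoids by (intro prod.cong) (auto simp: kink_def)
  then show ?thesis using m(1) by simp
next
  case False
  then have "(\<Prod>i<n. kink ((\<phi> ^^ i) y)) = (\<Prod>i<n. 1)"
    using avoids by (intro prod.cong) (auto simp: kink_def)
  then show ?thesis using kinks(2) by simp
qed

lemma centralizer_preserves_kink_orbit:
  assumes h: "h \<in> G" "h \<circ> \<phi> = \<phi> \<circ> h"
  shows "\<exists>i. h d1 = zpow \<phi> i d1"
proof -
  have d1: "d1 \<in> {0<..<r}" using lengths_pos gap by simp
  obtain k n where ends: "k < n" "slope_ratio h (zpow \<phi> (- int k) d1) 1"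
    "slope_ratio h ((\<phi> ^^ n) (zpow \<phi> (- int k) d1)) 1"
    using ex_smooth_orbit_ends[OF h(1) d1] by blast
  define y where "y = zpow \<phi> (- int k) d1"
  have y: "y \<in> {0<..<r}" using bump_on_zpow_mem_iff[OF bump_t] d1 by (simp add: y_def)
  have hits_kink: "(\<phi> ^^ k) y = d1"
    using zpow_zpow[OF bij_t, of "int k" "- int k" d1] by (simp add: y_def)
  have h_y_in: "h y \<in> {0<..<r}"
    using commute_bump_on_mem_iff[OF bump_t _ h(2)] bij_is_inj[OF bij_in[OF h(1)]] y by blast
  have "(\<Prod>i<n. kink ((\<phi> ^^ i) (h y))) = (\<Prod>i<n. kink ((\<phi> ^^ i) y))"
    using ends(2,3) by (intro orbit_kink_prod_commute h y) (simp_all add: y_def)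
  also have "\<dots> < \<beta>" using orbit_kink_prod_le[OF ends(1) hits_kink] kinks(1) by simp
  finally obtain i where i: "(\<phi> ^^ i) (h y) = d1"
    using orbit_kink_prod_ge[OF h_y_in, of n] by force
  have "h d1 = zpow \<phi> (int k) (h y)"
    using commute_zpow[OF bij_t h(2), of "int k"] hits_kink by (metis comp_apply zpow_of_nat)
  also have "\<dots> = zpow \<phi> (int k - int i) (zpow \<phi> (int i) (h y))"
    by (simp only: zpow_zpow[OF bij_t]) simp
  finally show ?thesis using i by auto
qed

lemma centralizer_eq_powers:
  assumes h: "h \<in> G" "h \<circ> \<phi> = \<phi> \<circ> h"
  shows "\<exists>i. h = zpow \<phi> i"
proof -
  have "d1 \<in> {0<..<r}" using lengths_pos gap by simp
  then show ?thesis using centralizer_preserves_kink_orbit[OF h] eq_zpow_if_commute[OF h] by blast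
qed

end

section \<open>Divisibility of exponents\<close>

lemma finite_translation_invariant_notin:
  fixes J :: "int set"
  assumes "finite J" "m \<noteq> 0" and shift: "\<And>i. m dvd i \<Longrightarrow> i \<noteq> 0 \<Longrightarrow> i \<in> J \<longleftrightarrow> i - m \<in> J"
  shows "0 \<notin> J" and "- m \<notin> J"
proof -
  have unbounded: False if "\<And>k. f k \<in> J" "inj f" for f :: "nat \<Rightarrow> int"
    using that finite_subset[of "range f" J] finite_imageD[of f UNIV] infinite_UNIV_nat assms(1)
    by blast
  have inj: "inj (\<lambda>k. m * int k)" "inj (\<lambda>k. - (m * int (Suc k)))"
    using assms(2) by (simp_all add: inj_def)
  show "0 \<notin> J"
  proof
    assume "0 \<in> J"
    have "m * int k \<in> J" for k
    proof (induction k)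
      case (Suc k)
      have "m * int (Suc k) \<noteq> 0" "m * int (Suc k) - m = m * int k"
        using assms(2) by (simp, simp add: algebra_simps)
      then show ?case using Suc shift[of "m * int (Suc k)"] by simp
    qed (use \<open>0 \<in> J\<close> in simp)
    then show False using unbounded[of "\<lambda>k. m * int k"] inj(1) by simp
  qed
  show "- m \<notin> J"
  proof
    assume "- m \<in> J"
    have "- (m * int (Suc k)) \<in> J" for k
    proof (induction k)
      case (Suc k)
      have "- (m * int (Suc k)) \<noteq> 0" using assms(2) by simp
      then have "- (m * int (Suc k)) - m \<in> J" using Suc shift[of "- (m * int (Suc k))"] by simp
      then show ?case by (simp add: algebra_simps)
    qed (use \<open>- m \<in> J\<close> in simp)
    then show False using unbounded[of "\<lambda>k. - (m * int (Suc k))"] inj(2) by blast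
  qed
qed

locale wreath_bumps = end_affine_group_bump G r t for G r t +
  fixes a u :: "real \<Rightarrow> real" and e :: real
  assumes a_in: "a \<in> G" and u_in: "u \<in> G" and e: "e \<in> {0<..<r}"
    and bump_a: "bump_on a e (t e)" and bump_u: "bump_on u 0 e"
    and centralizer_t: "h \<in> G \<Longrightarrow> h \<circ> t = t \<circ> h \<Longrightarrow> \<exists>i. h = zpow t i"
begin

definition cell :: "int \<Rightarrow> real set" where
  "cell i = {zpow t i e<..<zpow t (i + 1) e}"

definition conj_a :: "int \<Rightarrow> real \<Rightarrow> real" where
  "conj_a i = zconj t i a"

definition base :: "(real \<Rightarrow> real) set" where
  "base = {b \<in> G. \<forall>i. conj_a i \<circ> b = b \<circ> conj_a i}"

definition moved_cells :: "(real \<Rightarrow> real) \<Rightarrow> int set" where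
  "moved_cells b = {i. \<exists>y\<in>cell i. b y \<noteq> y}"

text \<open>For \<open>b \<in> base\<close>, this is the commutator equation \<open>[b, t\<^sup>m] = [a, t\<^sup>n]\<close>.\<close>

definition wreath_equation :: "int \<Rightarrow> int \<Rightarrow> (real \<Rightarrow> real) \<Rightarrow> bool" where
  "wreath_equation m n b \<longleftrightarrow> zconj t m b \<circ> a = conj_a n \<circ> b"

lemma conj_a_0 [simp]: "conj_a 0 = a"
  by (simp add: conj_a_def)

lemma strict_mono_orbit_e: "strict_mono (\<lambda>i. zpow t i e)"
  by (rule bump_on_orbit_strict_mono[OF bump_t e])

lemma zpow_mem_cell_iff: "zpow t m y \<in> cell i \<longleftrightarrow> y \<in> cell (i - m)"
proof -
  have less: "zpow t m x < zpow t m z \<longleftrightarrow> x < z" for x z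
    by (rule strict_mono_less[OF bump_on_zpow_strict_mono[OF bump_t]])
  have "zpow t j e = zpow t m (zpow t (j - m) e)" for j by (simp add: zpow_zpow[OF bij_t])
  from this[of i] this[of "i + 1"] show ?thesis by (simp add: cell_def less algebra_simps)
qed

lemma cell_disjoint:
  assumes "y \<in> cell i" "i \<noteq> j"
  shows "y \<notin> cell j"
proof
  assume "y \<in> cell j"
  then have "zpow t i e < zpow t (j + 1) e" "zpow t j e < zpow t (i + 1) e"
    using assms(1) by (auto simp: cell_def)
  then show False using assms(2) strict_mono_less[OF strict_mono_orbit_e] by simp
qed

lemma cell_subset: "cell i \<subseteq> {0<..<r}"
  using bump_on_zpow_mem_iff[OF bump_t, of i e] bump_on_zpow_mem_iff[OF bump_t, of "i + 1" e] e
  by (auto simp: cell_def)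

lemma cell_nonempty: "\<exists>y. y \<in> cell i"
  using dense[of "zpow t i e" "zpow t (i + 1) e"] strict_mono_less[OF strict_mono_orbit_e]
  by (simp add: cell_def)

lemma bump_conj_a: "bump_on (conj_a i) (zpow t i e) (zpow t (i + 1) e)"
proof -
  have "zpow t i (t e) = zpow t (i + 1) e"
    using zpow_zpow[OF bij_t, of i 1 e] by (simp add: bij_t)
  moreover have "bump_on (conj_a i) (zpow t i e) (zpow t i (t e))"
    unfolding conj_a_def zconj_def
    by (intro bump_on_conj bump_a bump_on_zpow_strict_mono[OF bump_t])
      (simp_all add: zpow_zpow[OF bij_t])
  ultimately show ?thesis by simp
qed

lemma conj_a_in: "conj_a i \<in> G"
  unfolding conj_a_def zconj_def by (intro comp_in zpow_in a_in)

lemma conj_a_commute: "conj_a i \<circ> conj_a j = conj_a j \<circ> conj_a i"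
proof -
  have "conj_a i \<circ> conj_a j = conj_a j \<circ> conj_a i" if "i < j" for i j
    using that strict_mono_less_eq[OF strict_mono_orbit_e]
    by (intro bump_on_commute_disjoint[OF bump_conj_a bump_conj_a]) simp
  then show ?thesis by (metis linorder_cases)
qed

lemma conj_a_in_base: "conj_a i \<in> base"
  using conj_a_in conj_a_commute by (simp add: base_def)

lemma base_comp: "b \<in> base \<Longrightarrow> b' \<in> base \<Longrightarrow> b \<circ> b' \<in> base"
  unfolding base_def using comp_in by (auto simp: fun_eq_iff)

lemma conj_a_eq_iff: "x \<circ> zpow t i = zpow t i \<circ> a \<longleftrightarrow> x = conj_a i"
  by (simp add: conj_a_def eq_zconj_iff[OF bij_t])

lemma conj_a_commute_u_iff: "conj_a i \<circ> u = u \<circ> conj_a i \<longleftrightarrow> 0 \<le> i"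
proof
  assume "0 \<le> i"
  then have "e \<le> zpow t i e" using strict_mono_less_eq[OF strict_mono_orbit_e, of 0 i] by simp
  then show "conj_a i \<circ> u = u \<circ> conj_a i"
    using bump_on_commute_disjoint[OF bump_u bump_conj_a] by simp
next
  assume comm: "conj_a i \<circ> u = u \<circ> conj_a i"
  show "0 \<le> i"
  proof (rule ccontr)
    assume "\<not> 0 \<le> i"
    let ?p = "zpow t i e" and ?q = "zpow t (i + 1) e"
    have "?p < e" "?p < ?q"
      using \<open>\<not> 0 \<le> i\<close> strict_mono_less[OF strict_mono_orbit_e, of i 0]
        strict_mono_less[OF strict_mono_orbit_e, of i "i + 1"] by simp_all
    moreover have "0 < ?p" using bump_on_zpow_mem_iff[OF bump_t, of i e] e by simp
    ultimately have "?p < min (u ?p) ?q" using bump_on_increases[OF bump_u, of ?p] by simp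
    then obtain y where y: "?p < y" "y < u ?p" "y < ?q" using dense[of ?p "min (u ?p) ?q"] by auto
    obtain z where z: "u z = y" using bij_in[OF u_in] by (metis bij_pointE)
    have "z \<in> {?p<..<?q}"
      using commute_bump_on_mem_iff[OF bump_conj_a, of u i z] comm z y
        bij_is_inj[OF bij_in[OF u_in]] by simp
    then have "u ?p < y"
      using strict_mono_less[OF bump_on_strict_mono[OF bump_u], of ?p z] z by simp
    then show False using y by simp
  qed
qed

lemma base_mem_cell_iff: "b \<in> base \<Longrightarrow> b y \<in> cell i \<longleftrightarrow> y \<in> cell i"
  unfolding cell_def base_def using bij_is_inj[OF bij_in]
  by (intro commute_bump_on_mem_iff[OF bump_conj_a]) auto

lemma base_fixes_affine_cell:
  assumes "b \<in> base" "affine_on {0<..} b X" "cell i \<subseteq> X"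
  shows "i \<notin> moved_cells b"
proof -
  have "surj b" using assms(1) bij_in by (simp add: base_def bij_is_surj)
  moreover have "affine_on {0<..} b (cell i)" using affine_on_mono[OF assms(2) _ assms(3)] by simp
  ultimately show ?thesis
    using affine_on_invariant_interval_fixes[of b "zpow t i e" "zpow t (i + 1) e"]
      base_mem_cell_iff[OF assms(1)]
    unfolding moved_cells_def cell_def by blast
qed

lemma finite_moved_cells:
  assumes b: "b \<in> base"
  shows "finite (moved_cells b)"
proof -
  have "b \<in> G" using b by (simp add: base_def)
  obtain \<epsilon> where \<epsilon>: "0 < \<epsilon>" "affine_on {0<..} b {0..<\<epsilon>}"
    using affine_near_0[OF \<open>b \<in> G\<close>] by blast
  obtain k where k: "zpow t (- int k) e < \<epsilon>"
    using bump_on_orbit_falls_below[OF bump_t e \<epsilon>(1)] by blast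
  obtain \<epsilon>' where \<epsilon>': "\<epsilon>' < r" "affine_on {0<..} b {\<epsilon>'<..<r}"
    using affine_near_r[OF \<open>b \<in> G\<close>] by blast
  obtain n where n: "\<epsilon>' < zpow t (int n) e" using bump_on_orbit_exceeds[OF bump_t e \<epsilon>'(1)] by auto
  have "i \<notin> moved_cells b" if "i < - int k" for i
  proof (rule base_fixes_affine_cell[OF b \<epsilon>(2)])
    have "zpow t (i + 1) e \<le> zpow t (- int k) e"
      using that strict_mono_less_eq[OF strict_mono_orbit_e] by simp
    then show "cell i \<subseteq> {0..<\<epsilon>}" using k cell_subset[of i] by (auto simp: cell_def)
  qed
  moreover have "i \<notin> moved_cells b" if "int n \<le> i" for i
  proof (rule base_fixes_affine_cell[OF b \<epsilon>'(2)])
    have "zpow t (int n) e \<le> zpow t i e"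
      using that strict_mono_less_eq[OF strict_mono_orbit_e] by blast
    then show "cell i \<subseteq> {\<epsilon>'<..<r}" using n cell_subset[of i] by (auto simp: cell_def)
  qed
  ultimately have "- int k \<le> i \<and> i < int n" if "i \<in> moved_cells b" for i
    using that by (meson not_le)
  then have "moved_cells b \<subseteq> {- int k..<int n}" by auto
  then show ?thesis by (rule finite_subset) simp
qed

lemma moved_cells_conj_a: "moved_cells (conj_a i) = {i}"
proof (intro equalityI subsetI)
  fix j assume "j \<in> moved_cells (conj_a i)"
  then obtain y where "y \<in> cell j" "conj_a i y \<noteq> y" by (auto simp: moved_cells_def)
  then have "y \<in> cell i" using bump_on_outside[OF bump_conj_a, of y i] by (auto simp: cell_def)
  then show "j \<in> {i}" using \<open>y \<in> cell j\<close> cell_disjoint by blast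
next
  fix j assume "j \<in> {i}"
  obtain y where "y \<in> cell i" using cell_nonempty by blast
  then have "conj_a i y \<noteq> y" using bump_on_increases[OF bump_conj_a, of y i] by (simp add: cell_def)
  then show "j \<in> moved_cells (conj_a i)"
    using \<open>y \<in> cell i\<close> \<open>j \<in> {i}\<close> by (auto simp: moved_cells_def)
qed

lemma moved_cells_zconj: "i \<in> moved_cells (zconj t m b) \<longleftrightarrow> i - m \<in> moved_cells b"
proof -
  have "zconj t m b y = y \<longleftrightarrow> b (zpow t (- m) y) = zpow t (- m) y" for y
    using bij_is_inj[OF bij_zpow[OF bij_t, of m]] zpow_zpow[OF bij_t, of m "- m" y]
    by (simp add: zconj_def) (metis injD)
  moreover have "(\<exists>y\<in>cell i. P (zpow t (- m) y)) \<longleftrightarrow> (\<exists>y\<in>cell (i - m). P y)" for P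
  proof
    assume "\<exists>y\<in>cell i. P (zpow t (- m) y)"
    then show "\<exists>y\<in>cell (i - m). P y" using zpow_mem_cell_iff[of "- m" _ "i - m"] by auto
  next
    assume "\<exists>y\<in>cell (i - m). P y"
    then obtain y where "y \<in> cell (i - m)" "P y" by blast
    then have "zpow t m y \<in> cell i" "P (zpow t (- m) (zpow t m y))"
      by (simp_all add: zpow_mem_cell_iff zpow_zpow[OF bij_t])
    then show "\<exists>y\<in>cell i. P (zpow t (- m) y)" by blast
  qed
  ultimately show ?thesis by (simp add: moved_cells_def)
qed

lemma conj_a_fixes: "y \<in> cell i \<Longrightarrow> i \<noteq> j \<Longrightarrow> conj_a j y = y"
  using moved_cells_conj_a[of j] by (auto simp: moved_cells_def)

text \<open>Read in the wreath product, the equation says that \<open>b\<close> and its translate by \<open>m\<close> agree except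
  at \<open>0\<close> and \<open>n\<close>.\<close>

lemma wreath_equation_moved_cells:
  assumes b: "b \<in> base" and eq: "wreath_equation m n b" and i: "i \<noteq> 0" "i \<noteq> n"
  shows "i \<in> moved_cells b \<longleftrightarrow> i - m \<in> moved_cells b"
proof -
  have "zconj t m b y = b y" if y: "y \<in> cell i" for y
  proof -
    have "zconj t m b (a y) = conj_a n (b y)"
      using eq by (simp add: wreath_equation_def fun_eq_iff)
    moreover have "a y = y" using conj_a_fixes[OF y, of 0] i(1) by simp
    moreover have "conj_a n (b y) = b y"
      using conj_a_fixes[of "b y" i n] base_mem_cell_iff[OF b] y i(2) by simp
    ultimately show ?thesis by simp
  qed
  then have "i \<in> moved_cells (zconj t m b) \<longleftrightarrow> i \<in> moved_cells b" by (auto simp: moved_cells_def)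
  then show ?thesis by (simp add: moved_cells_zconj)
qed

lemma wreath_equation_cell_0:
  assumes b: "b \<in> base" and eq: "wreath_equation m n b"
    and fixed: "0 \<notin> moved_cells b" "- m \<notin> moved_cells b"
  shows "n = 0"
proof (rule ccontr)
  assume "n \<noteq> 0"
  have "a y = y" if y: "y \<in> cell 0" for y
  proof -
    have "zconj t m b (a y) = conj_a n (b y)"
      using eq by (simp add: wreath_equation_def fun_eq_iff)
    moreover have "b y = y" using fixed(1) y by (auto simp: moved_cells_def)
    moreover have "conj_a n y = y" using conj_a_fixes[OF y] \<open>n \<noteq> 0\<close> by simp
    moreover have "a y \<in> cell 0" using base_mem_cell_iff[OF conj_a_in_base, of 0 y 0] y by simp
    moreover have "0 \<notin> moved_cells (zconj t m b)" using fixed(2) by (simp add: moved_cells_zconj)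
    ultimately show ?thesis by (auto simp: moved_cells_def)
  qed
  then show False using moved_cells_conj_a[of 0] by (auto simp: moved_cells_def)
qed

text \<open>If \<open>m\<close> does not divide \<open>n\<close>, then \<open>n\<close> does not lie in the class of \<open>0\<close> modulo \<open>m\<close>, on which
  \<open>b\<close> has finite support and therefore vanishes.\<close>

lemma dvd_if_wreath_equation:
  assumes b: "b \<in> base" and eq: "wreath_equation m n b"
  shows "m dvd n"
proof (rule ccontr)
  assume "\<not> m dvd n"
  then have "n \<noteq> 0" by auto
  show False
  proof (cases "m = 0")
    case True
    have "b \<circ> a = b \<circ> conj_a n" using eq b True by (simp add: wreath_equation_def base_def)
    moreover have "inj b" using b bij_in by (simp add: base_def bij_is_inj)
    ultimately have "a = conj_a n" by (simp add: fun_eq_iff inj_eq)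
    then show False using \<open>n \<noteq> 0\<close> moved_cells_conj_a[of 0] moved_cells_conj_a[of n] by simp
  next
    case False
    have shift: "i \<in> moved_cells b \<longleftrightarrow> i - m \<in> moved_cells b" if "m dvd i" "i \<noteq> 0" for i
    proof -
      have "i \<noteq> n" using that(1) \<open>\<not> m dvd n\<close> by blast
      then show ?thesis by (rule wreath_equation_moved_cells[OF b eq \<open>i \<noteq> 0\<close>])
    qed
    have "n = 0"
      using finite_translation_invariant_notin[OF finite_moved_cells[OF b] False shift]
      by (rule wreath_equation_cell_0[OF b eq])
    then show False using \<open>n \<noteq> 0\<close> by blast
  qed
qed

lemma wreath_equation_if_dvd:
  assumes "m dvd n"
  shows "\<exists>b\<in>base. wreath_equation (int m) (int n) b"
proof -
  have "\<exists>b\<in>base. wreath_equation (int m) (int (m * q)) b" for q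
  proof (induction q)
    case 0
    have "id \<in> base" using id_in by (simp add: base_def)
    moreover have "wreath_equation (int m) (int (m * 0)) id"
      unfolding wreath_equation_def zconj_id[OF bij_t] by simp
    ultimately show ?case by blast
  next
    case (Suc q)
    let ?c = "conj_a (int (m * q))" and ?c' = "conj_a (int (m * Suc q))"
    obtain b where b: "b \<in> base" "zconj t (int m) b \<circ> a = ?c \<circ> b"
      using Suc unfolding wreath_equation_def by blast
    have "zconj t (int m) (b \<circ> ?c) = zconj t (int m) b \<circ> ?c'"
      by (simp add: zconj_comp[OF bij_t] conj_a_def zconj_zconj[OF bij_t])
    then have "zconj t (int m) (b \<circ> ?c) \<circ> a = zconj t (int m) b \<circ> (?c' \<circ> a)"
      by (simp add: comp_assoc)
    also have "\<dots> = zconj t (int m) b \<circ> a \<circ> ?c'"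
      using conj_a_commute[of "int (m * Suc q)" 0] by (simp add: comp_assoc)
    also have "\<dots> = (?c \<circ> b) \<circ> ?c'" by (simp only: b(2))
    also have "\<dots> = ?c' \<circ> (b \<circ> ?c)"
    proof -
      have "?c \<circ> b = b \<circ> ?c" using b(1) by (simp add: base_def)
      moreover have "b \<circ> ?c \<in> base" using b(1) conj_a_in_base by (rule base_comp)
      ultimately show ?thesis by (simp add: base_def)
    qed
    finally show ?case
      unfolding wreath_equation_def using b(1) conj_a_in_base base_comp by blast
  qed
  then show ?thesis using assms by (elim dvdE) simp
qed

abbreviation mul :: "(real \<Rightarrow> real) \<Rightarrow> (real \<Rightarrow> real) \<Rightarrow> real \<Rightarrow> real" where
  "mul \<equiv> \<lambda>x y. y \<circ> x"

abbreviation definable_in_G :: "((nat \<Rightarrow> real \<Rightarrow> real) \<Rightarrow> bool) \<Rightarrow> bool" where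
  "definable_in_G \<equiv> definable G mul [t, a, u]"

lemma definable_term_comp:
  "definable_term mul ps f \<Longrightarrow> definable_term mul ps f' \<Longrightarrow> definable_term mul ps (\<lambda>g. f g \<circ> f' g)"
  by (rule definable_term_mult)

lemma commute_t_iff: "h \<in> G \<Longrightarrow> h \<circ> t = t \<circ> h \<longleftrightarrow> (\<exists>i. h = zpow t i)"
  using centralizer_t commute_zpow[OF bij_t, of t] by metis

lemma power_iff_conj_commute_u:
  assumes "h \<in> G"
  shows "h \<in> range (\<lambda>n. t ^^ n) \<longleftrightarrow>
    h \<circ> t = t \<circ> h \<and> (\<exists>x\<in>G. x \<circ> h = h \<circ> a \<and> x \<circ> u = u \<circ> x)"
proof -
  have "(\<exists>x\<in>G. x \<circ> zpow t i = zpow t i \<circ> a \<and> x \<circ> u = u \<circ> x) \<longleftrightarrow> 0 \<le> i" for i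
    unfolding conj_a_eq_iff using conj_a_in conj_a_commute_u_iff by auto
  then have "h \<circ> t = t \<circ> h \<and> (\<exists>x\<in>G. x \<circ> h = h \<circ> a \<and> x \<circ> u = u \<circ> x) \<longleftrightarrow> (\<exists>i\<ge>0. h = zpow t i)"
    using commute_t_iff[OF assms] by blast
  also have "\<dots> \<longleftrightarrow> (\<exists>n. h = zpow t (int n))" by (metis nonneg_int_cases of_nat_0_le_iff)
  finally show ?thesis by auto
qed

lemma base_iff_commute_conj:
  assumes "b \<in> G"
  shows "b \<in> base \<longleftrightarrow>
    (\<forall>h\<in>G. h \<circ> t = t \<circ> h \<longrightarrow> (\<forall>x\<in>G. x \<circ> h = h \<circ> a \<longrightarrow> x \<circ> b = b \<circ> x))"
proof -
  have "(\<forall>x\<in>G. x \<circ> zpow t i = zpow t i \<circ> a \<longrightarrow> x \<circ> b = b \<circ> x) \<longleftrightarrow> conj_a i \<circ> b = b \<circ> conj_a i" for i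
    unfolding conj_a_eq_iff using conj_a_in by blast
  then show ?thesis using assms zpow_in commute_t_iff unfolding base_def by (simp, metis)
qed

lemma definable_powers: "definable_in_G (\<lambda>g. g 0 \<in> range (\<lambda>n. t ^^ n))"
proof -
  have "definable_in_G (\<lambda>g. g 0 \<circ> t = t \<circ> g 0 \<and> (\<exists>x\<in>G. x \<circ> g 0 = g 0 \<circ> a \<and> x \<circ> u = u \<circ> x))"
    by (intro definable_intros definable_term_comp) simp_all
  then show ?thesis
    by (rule definable_cong[THEN iffD1, rotated]) (use power_iff_conj_commute_u in blast)
qed

lemma definable_base: "definable_in_G (\<lambda>g. g i \<in> base)"
proof -
  have "definable_in_G (\<lambda>g. \<forall>h\<in>G. h \<circ> t = t \<circ> h \<longrightarrow> (\<forall>x\<in>G. x \<circ> h = h \<circ> a \<longrightarrow> x \<circ> g i = g i \<circ> x))"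
    by (intro definable_intros definable_term_comp) simp_all
  then show ?thesis
    by (rule definable_cong[THEN iffD1, rotated]) (use base_iff_commute_conj in blast)
qed

text \<open>Naming the conjugates \<open>y\<close> of \<open>b\<close> and \<open>z\<close> of \<open>a\<close> avoids inverses, which are not in the
  language.\<close>

lemma dvd_iff_wreath_equation:
  "m dvd n \<longleftrightarrow> (\<exists>b\<in>G. b \<in> base \<and>
     (\<exists>y\<in>G. \<exists>z\<in>G. y \<circ> t ^^ m = t ^^ m \<circ> b \<and> z \<circ> t ^^ n = t ^^ n \<circ> a \<and> y \<circ> a = z \<circ> b))"
proof -
  have y: "y \<circ> t ^^ m = t ^^ m \<circ> b \<longleftrightarrow> y = zconj t (int m) b" for y b
    by (simp add: eq_zconj_iff[OF bij_t])
  have z: "z \<circ> t ^^ n = t ^^ n \<circ> a \<longleftrightarrow> z = conj_a (int n)" for z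
    using conj_a_eq_iff[of z "int n"] by simp
  have "zconj t (int m) b \<in> G" if "b \<in> G" for b
    unfolding zconj_def by (intro comp_in zpow_in that)
  then have "(\<exists>b\<in>G. b \<in> base \<and>
      (\<exists>y\<in>G. \<exists>z\<in>G. y \<circ> t ^^ m = t ^^ m \<circ> b \<and> z \<circ> t ^^ n = t ^^ n \<circ> a \<and> y \<circ> a = z \<circ> b)) \<longleftrightarrow>
    (\<exists>b\<in>base. wreath_equation (int m) (int n) b)"
    unfolding y z using conj_a_in by (auto simp: base_def wreath_equation_def)
  also have "\<dots> \<longleftrightarrow> m dvd n"
    using dvd_if_wreath_equation[of _ "int m" "int n"] wreath_equation_if_dvd by auto
  finally show ?thesis ..
qed

lemma definable_via_dvd: "definable_via G mul [t, a, u] (\<lambda>n. t ^^ n) (\<lambda>c. c 0 dvd c 1)"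
proof (rule definable_viaI)
  show "definable_in_G (\<lambda>g. \<exists>b\<in>G. b \<in> base \<and>
      (\<exists>y\<in>G. \<exists>z\<in>G. y \<circ> g 0 = g 0 \<circ> b \<and> z \<circ> g 1 = g 1 \<circ> a \<and> y \<circ> a = z \<circ> b))"
    by (intro definable_intros definable_base definable_term_comp) simp_all
qed (rule dvd_iff_wreath_equation[symmetric])

theorem interprets_arith: "interprets_arith_params G mul id"
proof -
  interpret add_dvd_coordinates G mul id "[t, a, u]" "\<lambda>n. t ^^ n"
  proof
    show "range (\<lambda>n. t ^^ n) \<subseteq> G" using zpow_in[of "int n" for n] by auto
    show "inj (\<lambda>n. t ^^ n)"
    proof (rule injI)
      fix m n assume "t ^^ m = t ^^ n"
      then have "zpow t (int m) e = zpow t (int n) e" by simp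
      then show "m = n" using strict_mono_eq[OF strict_mono_orbit_e, of "int m" "int n"] by simp
    qed
    show "t ^^ (i + j) = t ^^ j \<circ> t ^^ i" for i j by (metis add.commute funpow_add)
    show "definable_in_G (\<lambda>g. g 0 \<in> range (\<lambda>n. t ^^ n))" by (rule definable_powers)
    show "definable_via G mul [t, a, u] (\<lambda>n. t ^^ n) (\<lambda>c. c 0 dvd c 1)"
      by (rule definable_via_dvd)
  qed (use t_in a_in u_in in simp_all)
  show ?thesis by (rule interprets_arith)
qed

end

section \<open>Membership in the groups V and F\<close>

lemma ex_consecutive_enumeration:
  fixes l u :: "'a::linorder"
  assumes P: "finite P" "P \<subseteq> {l..u}" "l \<in> P" "u \<in> P"
  obtains n :: nat and a where "a 0 = l" "a n = u" "\<And>i. i \<le> n \<Longrightarrow> a i \<in> P"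
    "\<And>i. i < n \<Longrightarrow> a i < a (Suc i)"
    "\<And>i z. i < n \<Longrightarrow> z \<in> P \<Longrightarrow> z \<le> a i \<or> a (Suc i) \<le> z"
proof -
  define xs where "xs = sorted_list_of_set P"
  define n where "n = length xs - 1"
  have set: "set xs = P" using P(1) by (simp add: xs_def)
  have sorted: "sorted_wrt (<) xs" unfolding xs_def by (rule strict_sorted_list_of_set)
  have len: "length xs = Suc n" using set P(3) by (cases xs) (auto simp: n_def)
  have nth_less: "xs ! i < xs ! j" if "i < j" "j \<le> n" for i j
    using sorted_wrt_nth_less[OF sorted] that len by simp
  then have nth_le: "xs ! i \<le> xs ! j" if "i \<le> j" "j \<le> n" for i j
    using that by (metis le_neq_implies_less less_imp_le order_refl)
  have nth_in: "xs ! i \<in> P" if "i \<le> n" for i using that len set by (metis le_imp_less_Suc nth_mem)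
  have index: "\<exists>i\<le>n. z = xs ! i" if "z \<in> P" for z
    using that len set by (metis in_set_conv_nth less_Suc_eq_le)
  show ?thesis
  proof (rule that[of "(!) xs" n])
    obtain i where "i \<le> n" "l = xs ! i" using index[OF P(3)] by blast
    then show "xs ! 0 = l" using nth_le[of 0 i] subsetD[OF P(2) nth_in[of 0]] by simp
    obtain j where "j \<le> n" "u = xs ! j" using index[OF P(4)] by blast
    then show "xs ! n = u" using nth_le[of j n] subsetD[OF P(2) nth_in[of n]] by simp
  next
    fix i z assume "i < n" "z \<in> P"
    then obtain j where "j \<le> n" "z = xs ! j" using index by blast
    then show "z \<le> xs ! i \<or> xs ! Suc i \<le> z"
      using nth_le[of j i] nth_le[of "Suc i" j] \<open>i < n\<close> by (cases "j \<le> i") auto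
  qed (use nth_in nth_less in auto)
qed

lemma PL_V_if_finite_breakpoints:
  assumes outside: "\<And>y. y \<notin> {0..<r} \<Longrightarrow> f y = y" and bij: "bij_betw f {0..<r} {0..<r}"
    and P: "finite P" "P \<subseteq> {0..r}" "P \<subseteq> A" "0 \<in> P" "r \<in> P" "f ` P \<subseteq> A"
    and aff: "\<And>x y. x < y \<Longrightarrow> (\<And>z. z \<in> P \<Longrightarrow> z \<le> x \<or> y \<le> z) \<Longrightarrow> affine_on \<Lambda> f {x..<y}"
  shows "f \<in> PL_V r \<Lambda> A"
proof -
  obtain n :: nat and a where a: "a 0 = 0" "a n = r" "\<And>i. i \<le> n \<Longrightarrow> a i \<in> P"
    "\<And>i. i < n \<Longrightarrow> a i < a (Suc i)"
    "\<And>i z. i < n \<Longrightarrow> z \<in> P \<Longrightarrow> z \<le> a i \<or> a (Suc i) \<le> z"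
    by (rule ex_consecutive_enumeration[OF P(1,2,4,5)]) blast
  have "a i \<in> A" "f (a i) \<in> A" if "i \<le> n" for i using a(3)[OF that] P(3,6) by auto
  moreover have "affine_on \<Lambda> f {a i..<a (Suc i)}" if "i < n" for i
    using a(4,5)[OF that] by (rule aff)
  ultimately have "\<exists>n a. a 0 = 0 \<and> a n = r \<and> (\<forall>i<n. a i < a (Suc i)) \<and> (\<forall>i\<le>n. a i \<in> A) \<and>
      (\<forall>i<n. f (a i) \<in> A \<and> affine_on \<Lambda> f {a i..<a (Suc i)})"
    using a by (intro exI[of _ n] exI[of _ a]) simp
  then show ?thesis unfolding PL_V_def affine_on_def using outside bij by blast
qed

lemma PL_VE:
  assumes "f \<in> PL_V r \<Lambda> A"
  obtains n :: nat and a where "a 0 = 0" "a n = r" "\<And>i. i < n \<Longrightarrow> a i < a (Suc i)"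
    "\<And>i. i < n \<Longrightarrow> affine_on \<Lambda> f {a i..<a (Suc i)}"
proof -
  have "\<exists>(n::nat) a. a 0 = 0 \<and> a n = r \<and> (\<forall>i<n. a i < a (Suc i)) \<and> (\<forall>i\<le>n. a i \<in> A) \<and>
      (\<forall>i<n. f (a i) \<in> A \<and> affine_on \<Lambda> f {a i..<a (Suc i)})"
    using assms unfolding PL_V_def affine_on_def mem_Collect_eq by (elim conjE)
  then show ?thesis using that by (elim exE conjE) simp
qed

lemma PL_V_affine_near_0:
  assumes "f \<in> PL_V r \<Lambda> A" "0 < r"
  shows "\<exists>\<epsilon>>0. affine_on \<Lambda> f {0..<\<epsilon>}"
proof -
  obtain n :: nat and a where a: "a 0 = 0" "a n = r" "\<And>i. i < n \<Longrightarrow> a i < a (Suc i)"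
    "\<And>i. i < n \<Longrightarrow> affine_on \<Lambda> f {a i..<a (Suc i)}"
    using assms(1) by (rule PL_VE) blast
  have "0 < n" using a(1,2) assms(2) by (cases n) auto
  then show ?thesis using a(1) a(3,4)[of 0] by auto
qed

lemma PL_V_affine_near_r:
  assumes "f \<in> PL_V r \<Lambda> A" "0 < r"
  shows "\<exists>\<epsilon><r. affine_on \<Lambda> f {\<epsilon><..<r}"
proof -
  obtain n :: nat and a where a: "a 0 = 0" "a n = r" "\<And>i. i < n \<Longrightarrow> a i < a (Suc i)"
    "\<And>i. i < n \<Longrightarrow> affine_on \<Lambda> f {a i..<a (Suc i)}"
    using assms(1) by (rule PL_VE) blast
  obtain m where m: "n = Suc m" using a(1,2) assms(2) by (cases n) auto
  have "affine_on \<Lambda> f {a m<..<r}"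
    by (rule affine_on_mono[OF a(4)[of m]]) (use a(2) m in auto)
  then show ?thesis using a(2) a(3)[of m] m by auto
qed

lemma PL_V_bij:
  assumes "f \<in> PL_V r \<Lambda> A"
  shows "bij f"
proof -
  have "bij_betw f {0..<r} {0..<r}" using assms by (simp add: PL_V_def)
  moreover have "bij_betw f (- {0..<r}) (- {0..<r})"
    using assms bij_betw_cong[of "- {0..<r}" f id] by (auto simp: PL_V_def)
  ultimately show ?thesis
    using bij_betw_combine[of f "{0..<r}" "{0..<r}" "- {0..<r}" "- {0..<r}"] by simp
qed

lemma end_affine_group_if_subgroup:
  assumes "0 < r" and G: "subgroup G (Vgrp r {0<..} UNIV)"
  shows "end_affine_group G r"
proof
  have sub: "G \<subseteq> PL_V r {0<..} UNIV" using subgroup.subset[OF G] by (simp add: Vgrp_def)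
  show "id \<in> G" using subgroup.one_closed[OF G] by (simp add: Vgrp_def)
  show "x \<circ> y \<in> G" if "x \<in> G" "y \<in> G" for x y
    using subgroup.m_closed[OF G that(2,1)] by (simp add: Vgrp_def)
  fix x assume "x \<in> G"
  then have x: "x \<in> PL_V r {0<..} UNIV" using sub by blast
  show "bij x" using x by (rule PL_V_bij)
  show "v \<notin> {0..<r} \<Longrightarrow> x v = v" for v using x by (simp add: PL_V_def)
  show "\<exists>\<epsilon>>0. affine_on {0<..} x {0..<\<epsilon>}" by (rule PL_V_affine_near_0[OF x assms(1)])
  show "\<exists>\<epsilon><r. affine_on {0<..} x {\<epsilon><..<r}" by (rule PL_V_affine_near_r[OF x assms(1)])
qed (rule assms(1))

lemma strict_mono_bij_betw_atLeastLessThan: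
  fixes f :: "'a::linorder \<Rightarrow> 'b::linorder"
  assumes f: "strict_mono f" "surj f"
  shows "bij_betw f {x..<y} {f x..<f y}"
  unfolding bij_betw_def
proof
  show "inj_on f {x..<y}" by (rule strict_mono_imp_inj_on[OF f(1)])
  show "f ` {x..<y} = {f x..<f y}"
  proof (intro equalityI subsetI)
    fix z assume "z \<in> {f x..<f y}"
    moreover obtain w where "z = f w" using f(2) by blast
    ultimately show "z \<in> f ` {x..<y}"
      using strict_mono_less[OF f(1)] strict_mono_less_eq[OF f(1)] by auto
  qed (auto simp: strict_mono_less[OF f(1)] strict_mono_less_eq[OF f(1)])
qed

lemma (in three_pieces) affine_on_between_breakpoints:
  assumes "\<And>z. z \<in> {p, p + d1, q - d2, q} \<Longrightarrow> z \<le> x \<or> y \<le> z"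
  shows "affine_on {1, \<alpha>, \<beta>} \<phi> {x..<y}"
proof -
  have piece: ?thesis if "affine_on {s} \<phi> X" "s \<in> {1, \<alpha>, \<beta>}" "{x..<y} \<subseteq> X" for s X
    by (rule affine_on_mono[OF that(1)]) (use that(2,3) in auto)
  consider "x < p" | "p \<le> x" "x < p + d1" | "p + d1 \<le> x" "x < q - d2" | "q - d2 \<le> x" "x < q"
    | "q \<le> x"
    by force
  then show ?thesis
  proof cases
    case 1
    then show ?thesis using assms[of p] by (intro piece[OF affine_on_pieces(1)]) auto
  next
    case 2
    then show ?thesis using assms[of "p + d1"] by (intro piece[OF affine_on_pieces(2)]) auto
  next
    case 3
    then show ?thesis using assms[of "q - d2"] by (intro piece[OF affine_on_pieces(3)]) auto
  next
    case 4
    then show ?thesis using assms[of q] by (intro piece[OF affine_on_pieces(4)]) auto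
  next
    case 5
    then show ?thesis by (intro piece[OF affine_on_pieces(5)]) auto
  qed
qed

locale scalable_subgroup =
  fixes \<Lambda> A :: "real set"
  assumes Lambda_pos: "\<Lambda> \<subseteq> {0<..}"
    and Lambda_one: "1 \<in> \<Lambda>"
    and Lambda_mult: "x \<in> \<Lambda> \<Longrightarrow> y \<in> \<Lambda> \<Longrightarrow> x * y \<in> \<Lambda>"
    and Lambda_inverse: "x \<in> \<Lambda> \<Longrightarrow> inverse x \<in> \<Lambda>"
    and Lambda_nontrivial: "\<Lambda> \<noteq> {1}"
    and A_zero: "0 \<in> A"
    and A_add: "x \<in> A \<Longrightarrow> y \<in> A \<Longrightarrow> x + y \<in> A"
    and A_uminus: "x \<in> A \<Longrightarrow> - x \<in> A"
    and A_scale: "s \<in> \<Lambda> \<Longrightarrow> x \<in> A \<Longrightarrow> s * x \<in> A"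
begin

lemma A_diff: "x \<in> A \<Longrightarrow> y \<in> A \<Longrightarrow> x - y \<in> A"
  using A_add[of x "- y"] A_uminus[of y] by simp

lemma three_piece_map_in_PL_F:
  assumes "three_pieces p q d1 d2 \<alpha> \<beta>" "0 \<le> p" "q \<le> r"
    and A: "p \<in> A" "q \<in> A" "r \<in> A" "d1 \<in> A" "d2 \<in> A" and \<Lambda>: "\<alpha> \<in> \<Lambda>" "\<beta> \<in> \<Lambda>"
  shows "three_piece_map p q d1 d2 \<alpha> \<beta> \<in> PL_F r \<Lambda> A"
proof -
  interpret three_pieces p q d1 d2 \<alpha> \<beta> by (rule assms(1))
  let ?P = "{0, p, p + d1, q - d2, q, r}"
  have ends: "\<phi> 0 = 0" "\<phi> r = r" using outside_piece assms(2,3) by auto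
  have "\<phi> \<in> PL_V r \<Lambda> A"
  proof (rule PL_V_if_finite_breakpoints)
    show "\<phi> y = y" if "y \<notin> {0..<r}" for y using that assms(2,3) by (intro outside_piece) auto
    show "bij_betw \<phi> {0..<r} {0..<r}"
      using strict_mono_bij_betw_atLeastLessThan[of \<phi> 0 r]
        strict_mono_three_piece_map surj_three_piece_map by (simp add: ends)
    show "?P \<subseteq> {0..r}" using assms(2,3) lengths_pos fit by auto
    show "?P \<subseteq> A" using A A_zero A_add A_diff by simp
    have "\<phi> p = p" "\<phi> q = q" "\<phi> (p + d1) = p + \<alpha> * d1" "\<phi> (q - d2) = q - \<beta> * d2"
      using lengths_pos by (simp_all add: outside_piece left_piece right_piece)
    then show "\<phi> ` ?P \<subseteq> A" using ends A \<Lambda> A_zero A_add A_diff A_scale by simp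
    show "affine_on \<Lambda> \<phi> {x..<y}" if "\<And>z. z \<in> ?P \<Longrightarrow> z \<le> x \<or> y \<le> z" for x y
    proof (rule affine_on_mono)
      show "affine_on {1, \<alpha>, \<beta>} \<phi> {x..<y}" using that by (intro affine_on_between_breakpoints) blast
      show "{1, \<alpha>, \<beta>} \<subseteq> \<Lambda>" using \<Lambda> Lambda_one by simp
    qed simp
  qed simp_all
  moreover have "continuous_on UNIV \<phi>"
    by (rule continuous_onI_mono)
      (use surj_three_piece_map strict_mono_less_eq[OF strict_mono_three_piece_map] in auto)
  ultimately show ?thesis unfolding PL_F_def using continuous_on_subset by auto
qed

lemma inv_three_piece_map_in_PL_F:
  assumes "three_pieces p q d1 d2 \<alpha> \<beta>" "0 \<le> p" "q \<le> r"
    and "p \<in> A" "q \<in> A" "r \<in> A" "d1 \<in> A" "d2 \<in> A" and "\<alpha> \<in> \<Lambda>" "\<beta> \<in> \<Lambda>"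
  shows "inv_into UNIV (three_piece_map p q d1 d2 \<alpha> \<beta>) \<in> PL_F r \<Lambda> A"
  unfolding three_pieces.inv_three_piece_map[OF assms(1)]
  by (rule three_piece_map_in_PL_F[OF three_pieces.three_pieces_inverse[OF assms(1)] assms(2-6)])
    (use assms A_scale Lambda_inverse in \<open>simp_all add: divide_inverse\<close>)

lemma ex_Lambda_gt_1: "\<exists>l\<in>\<Lambda>. 1 < l"
proof -
  obtain x where x: "x \<in> \<Lambda>" "x \<noteq> 1" using Lambda_one Lambda_nontrivial by blast
  moreover have "0 < x" using Lambda_pos x(1) by auto
  ultimately have "1 < x \<or> 1 < inverse x" by (auto simp: one_less_inverse_iff)
  then show ?thesis using x(1) Lambda_inverse by blast
qed

lemma ex_small_in_A:
  assumes "y \<in> A" "0 < y"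
  shows "\<exists>x\<in>A. 0 < x \<and> x * k < y"
proof -
  obtain l where l: "l \<in> \<Lambda>" "1 < l" using ex_Lambda_gt_1 by blast
  obtain n where n: "k < l ^ n" using real_arch_pow[OF l(2)] by blast
  have "inverse l ^ n * y \<in> A"
    by (induction n) (use assms(1) A_scale Lambda_inverse[OF l(1)] in \<open>simp_all add: mult.assoc\<close>)
  moreover have "inverse l ^ n * y * k < y"
    using mult_strict_left_mono[OF n assms(2)] l(2) by (simp add: field_simps)
  moreover have "0 < inverse l ^ n * y" using assms(2) l(2) by simp
  ultimately show ?thesis by blast
qed

text \<open>With the slopes \<open>l\<close> and \<open>1 / l\<close> both kinks would have the ratio \<open>1 / l\<close>, hence \<open>l\<^sup>2\<close>.\<close>

lemma ex_three_pieces: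
  assumes "p < q" "p \<in> A" "q \<in> A"
  obtains d1 d2 \<alpha> \<beta> where "three_pieces p q d1 d2 \<alpha> \<beta>" "d1 \<in> A" "d2 \<in> A" "\<alpha> \<in> \<Lambda>" "\<beta> \<in> \<Lambda>"
    "p + d1 < q - d2" "1 < \<alpha>" "1 / \<alpha> < \<beta>" "\<beta> < 1"
proof -
  obtain l where l: "l \<in> \<Lambda>" "1 < l" using ex_Lambda_gt_1 by blast
  obtain d where d: "d \<in> A" "0 < d" "d * (1 + l + l\<^sup>2) < q - p"
    using ex_small_in_A[OF A_diff[OF assms(3,2)]] assms(1) by auto
  have \<Lambda>: "l\<^sup>2 \<in> \<Lambda>" "1 / l \<in> \<Lambda>"
    using l(1) Lambda_mult Lambda_inverse by (simp_all add: power2_eq_square divide_inverse)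
  have gap: "p + d < q - (l + l\<^sup>2) * d" using d(3) by (simp add: algebra_simps)
  have "(l\<^sup>2 - 1) * d = (1 - 1 / l) * ((l + l\<^sup>2) * d)"
    using l(2) by (simp add: field_simps power2_eq_square)
  then have "three_pieces p q d ((l + l\<^sup>2) * d) (l\<^sup>2) (1 / l)"
    using l(2) d(2) gap by unfold_locales (simp_all add: add_pos_pos)
  moreover have "(l + l\<^sup>2) * d \<in> A" using A_add A_scale \<Lambda>(1) l(1) d(1) by (simp add: distrib_right)
  moreover have "1 < l\<^sup>2" "1 / l\<^sup>2 < 1 / l" "1 / l < 1"
    using l(2) by (simp_all add: power2_eq_square field_simps less_1_mult)
  ultimately show ?thesis using that d(1) \<Lambda> gap by blast
qed

lemma ex_bump_in_PL_F:
  assumes "p < q" "0 \<le> p" "q \<le> r" "p \<in> A" "q \<in> A" "r \<in> A"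
  shows "\<exists>x\<in>PL_F r \<Lambda> A. bump_on x p q"
proof -
  obtain d1 d2 \<alpha> \<beta> where "three_pieces p q d1 d2 \<alpha> \<beta>" "d1 \<in> A" "d2 \<in> A" "\<alpha> \<in> \<Lambda>" "\<beta> \<in> \<Lambda>" "1 < \<alpha>"
    using ex_three_pieces[OF assms(1,4,5)] by metis
  then show ?thesis
    using three_piece_map_in_PL_F three_pieces.bump_on_three_piece_map assms by blast
qed

theorem interprets_arith_if_PL_F_subset:
  assumes "end_affine_group G r" and F_subset: "PL_F r \<Lambda> A \<subseteq> G" and r_in: "r \<in> A"
  shows "interprets_arith_params G (\<lambda>x y. y \<circ> x) id"
proof -
  interpret end_affine_group G r by (rule assms(1))
  obtain d1 d2 \<alpha> \<beta> where pieces: "three_pieces 0 r d1 d2 \<alpha> \<beta>"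
    and A: "d1 \<in> A" "d2 \<in> A" and \<Lambda>: "\<alpha> \<in> \<Lambda>" "\<beta> \<in> \<Lambda>"
    and slopes: "0 + d1 < r - d2" "1 < \<alpha>" "1 / \<alpha> < \<beta>" "\<beta> < 1"
    by (rule ex_three_pieces[OF r_pos A_zero r_in])
  interpret three_pieces 0 r d1 d2 \<alpha> \<beta> by (rule pieces)
  let ?t = "three_piece_map 0 r d1 d2 \<alpha> \<beta>"
  have "?t \<in> G" "inv_into UNIV ?t \<in> G"
    using F_subset three_piece_map_in_PL_F[OF pieces _ _ A_zero r_in r_in A \<Lambda>]
      inv_three_piece_map_in_PL_F[OF pieces _ _ A_zero r_in r_in A \<Lambda>] by auto
  then interpret end_affine_group_three_pieces G r d1 d2 \<alpha> \<beta>
    using bump_on_three_piece_map slopes by unfold_locales auto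
  have d1: "d1 \<in> {0<..<r}" using lengths_pos gap by simp
  then have t_d1: "d1 < ?t d1" "?t d1 \<in> {0<..<r}"
    using bump_on_increases[OF bump_t] bump_on_mem_iff[OF bump_t] by blast+
  have "?t d1 \<in> A" using A_scale[OF \<Lambda>(1) A(1)] lengths_pos by (simp add: left_piece)
  then obtain a where a: "a \<in> G" "bump_on a d1 (?t d1)"
    using ex_bump_in_PL_F[OF t_d1(1), of r] t_d1(2) d1 A(1) r_in F_subset by auto
  obtain u where u: "u \<in> G" "bump_on u 0 d1"
    using ex_bump_in_PL_F[of 0 d1 r] d1 A(1) A_zero r_in F_subset by auto
  interpret wreath_bumps G r ?t a u d1
    using a u d1 centralizer_eq_powers by unfold_locales
  show ?thesis by (rule interprets_arith)
qed

end

theorem theoremA: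
  fixes r :: real and \<Lambda> A :: "real set" and G :: "(real \<Rightarrow> real) set"
  assumes r_pos: "r > 0"
    and Lambda_pos: "\<Lambda> \<subseteq> {0<..}"
    and Lambda_one: "1 \<in> \<Lambda>"
    and Lambda_mult: "\<forall>x\<in>\<Lambda>. \<forall>y\<in>\<Lambda>. x * y \<in> \<Lambda>"
    and Lambda_inv: "\<forall>x\<in>\<Lambda>. inverse x \<in> \<Lambda>"
    and Lambda_nontriv: "\<Lambda> \<noteq> {1}"
    and A_zero: "0 \<in> A"
    and A_add: "\<forall>x\<in>A. \<forall>y\<in>A. x + y \<in> A"
    and A_uminus: "\<forall>x\<in>A. - x \<in> A"
    and r_in_A: "r \<in> A"
    and A_Lambda: "\<forall>s\<in>\<Lambda>. \<forall>a\<in>A. s * a \<in> A"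
    and G_sub: "subgroup G (Vgrp r {0<..} UNIV)"
    and G_F: "G \<inter> PL_F r {0<..} UNIV = PL_F r \<Lambda> A"
  shows "interprets_arith_params G (\<lambda>x y. y \<circ> x) id"
proof -
  interpret scalable_subgroup \<Lambda> A using assms by unfold_locales auto
  have "end_affine_group G r" using r_pos G_sub by (rule end_affine_group_if_subgroup)
  moreover have "PL_F r \<Lambda> A \<subseteq> G" using G_F by blast
  ultimately show ?thesis using r_in_A by (rule interprets_arith_if_PL_F_subset)
qed

end
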